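(* Among locally compact compactly generated groups, being compactly presented is a quasi-isometry invariant: if $G$ and $H$ are locally compact compactly generated groups which, endowed with word metrics with respect to compact generating subsets, are quasi-isometric, then $G$ is compactly presented if and only if $H$ is compactly presented.
   Context: Locally compact groups are assumed Hausdorff. A topological group is compactly generated if it is generated, as an abstract group, by a compact subset. For a generating subset $S$ of a group $G$, the word metric is $d_S(g,h)=$ least $n\ge0$ such that $g^{-1}h$ is a product of $n$ elements of $S\cup S^{-1}$. A group $G$ is boundedly presented by a subset $S\subset G$ if, as an abstract group, it has a presentation with $S$ as set of generators and with relators of bounded length. A topological group $G$ is compactly presented if it is Hausdorff and there is a compact subset $S\subset G$ such that the abstract group $G$ is boundedly presented by $S$. Metric spaces $X,Y$ are quasi-isometric if there are maps $f:X\to Y$, $g:Y\to X$ and constants $A,B,\alpha,\beta,C,\gamma\ge 0$ with $d(f(x),f(x'))\le A\,d(x,x')+B$, $d(g(y),g(y'))\le\alpha\, d(y,y')+\beta$, $d(g(f(x)),x)\le C$ and $d(f(g(y)),y)\le\gamma$ for all $x,x'\in X$, $y,y'\in Y$. *)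

theory Defs
  imports "HOL-Analysis.Analysis" "HOL-Algebra.Generated_Groups"
begin

section \<open>Locally compact groups\<close>

locale topological_group = group G for G (structure) and X +
  assumes topspace_eq: "topspace X = carrier G"
    and continuous_mult: "continuous_map (prod_topology X X) X (\<lambda>(x, y). x \<otimes> y)"
    and continuous_inv: "continuous_map X X (\<lambda>x. inv x)"

locale locally_compact_group = topological_group +
  assumes Hausdorff: "Hausdorff_space X"
    and locally_compact: "locally_compact_space X"

definition compact_generating_set ::
    "('a, 'm) monoid_scheme \<Rightarrow> 'a topology \<Rightarrow> 'a set \<Rightarrow> bool" where
  "compact_generating_set G X S \<longleftrightarrow> compactin X S \<and> generate G S = carrier G"

section \<open>Word metrics and quasi-isometries\<close>

definition list_prod :: "('a, 'm) monoid_scheme \<Rightarrow> 'a list \<Rightarrow> 'a" where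
  "list_prod G ws = foldr (\<otimes>\<^bsub>G\<^esub>) ws \<one>\<^bsub>G\<^esub>"

text \<open>The value \<open>0\<close> outside the carrier only serves to meet the conventions of
  \<^locale>\<open>Metric_space\<close>, which asks for symmetry on the whole type.\<close>

definition word_dist :: "('a, 'm) monoid_scheme \<Rightarrow> 'a set \<Rightarrow> 'a \<Rightarrow> 'a \<Rightarrow> real" where
  "word_dist G S g h =
    (if g \<in> carrier G \<and> h \<in> carrier G
     then real (LEAST n. \<exists>ws. length ws = n \<and> set ws \<subseteq> S \<union> set_inv\<^bsub>G\<^esub> S \<and>
                  list_prod G ws = inv\<^bsub>G\<^esub> g \<otimes>\<^bsub>G\<^esub> h)
     else 0)"

definition word_metric :: "('a, 'm) monoid_scheme \<Rightarrow> 'a set \<Rightarrow> 'a metric" where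
  "word_metric G S = metric (carrier G, word_dist G S)"

definition quasi_isometric :: "'a metric \<Rightarrow> 'b metric \<Rightarrow> bool" where
  "quasi_isometric X Y \<longleftrightarrow>
    (\<exists>f g A B \<alpha> \<beta> C \<gamma>.
      f \<in> mspace X \<rightarrow> mspace Y \<and> g \<in> mspace Y \<rightarrow> mspace X \<and>
      0 \<le> A \<and> 0 \<le> B \<and> 0 \<le> \<alpha> \<and> 0 \<le> \<beta> \<and> 0 \<le> C \<and> 0 \<le> \<gamma> \<and>
      (\<forall>x\<in>mspace X. \<forall>x'\<in>mspace X. mdist Y (f x) (f x') \<le> A * mdist X x x' + B) \<and>
      (\<forall>y\<in>mspace Y. \<forall>y'\<in>mspace Y. mdist X (g y) (g y') \<le> \<alpha> * mdist Y y y' + \<beta>) \<and>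
      (\<forall>x\<in>mspace X. mdist X (g (f x)) x \<le> C) \<and>
      (\<forall>y\<in>mspace Y. mdist Y (f (g y)) y \<le> \<gamma>))"

section \<open>Free groups\<close>

text \<open>A letter \<open>(s, True)\<close> stands for the generator \<open>s\<close>, and \<open>(s, False)\<close> for its formal
  inverse. The free group on \<open>S\<close> consists of the freely reduced words, so the length of an
  element of the free group is the length of the list.\<close>

type_synonym 'a letter = "'a \<times> bool"

definition inv_letter :: "'a letter \<Rightarrow> 'a letter" where
  "inv_letter l = (fst l, \<not> snd l)"

definition reduced :: "'a letter list \<Rightarrow> bool" where
  "reduced w \<longleftrightarrow> successively (\<lambda>x y. y \<noteq> inv_letter x) w"

fun reduced_Cons :: "'a letter \<Rightarrow> 'a letter list \<Rightarrow> 'a letter list" where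
  "reduced_Cons x [] = [x]"
| "reduced_Cons x (y # ys) = (if y = inv_letter x then ys else x # y # ys)"

definition reduce :: "'a letter list \<Rightarrow> 'a letter list" where
  "reduce w = foldr reduced_Cons w []"

definition free_group :: "'a set \<Rightarrow> 'a letter list monoid" where
  "free_group S = \<lparr>carrier = {w. reduced w \<and> fst ` set w \<subseteq> S},
     mult = (\<lambda>u v. reduce (u @ v)), one = []\<rparr>"

section \<open>Presentations\<close>

text \<open>For \<open>S \<subseteq> carrier G\<close>, the map \<open>word_value G\<close> is the homomorphism from the free group on
  \<open>S\<close> to \<open>G\<close> that extends the inclusion of \<open>S\<close>.\<close>

definition letter_value :: "('a, 'm) monoid_scheme \<Rightarrow> 'a letter \<Rightarrow> 'a" where
  "letter_value G l = (if snd l then fst l else inv\<^bsub>G\<^esub> (fst l))"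

definition word_value :: "('a, 'm) monoid_scheme \<Rightarrow> 'a letter list \<Rightarrow> 'a" where
  "word_value G w = list_prod G (map (letter_value G) w)"

definition normal_closure :: "('a, 'm) monoid_scheme \<Rightarrow> 'a set \<Rightarrow> 'a set" where
  "normal_closure G R = \<Inter>{N. N \<lhd> G \<and> R \<subseteq> N}"

definition is_presentation ::
    "('a, 'm) monoid_scheme \<Rightarrow> 'a set \<Rightarrow> 'a letter list set \<Rightarrow> bool" where
  "is_presentation G S R \<longleftrightarrow>
    S \<subseteq> carrier G \<and> R \<subseteq> carrier (free_group S) \<and>
    word_value G ` carrier (free_group S) = carrier G \<and>
    kernel (free_group S) G (word_value G) = normal_closure (free_group S) R"

definition boundedly_presented :: "('a, 'm) monoid_scheme \<Rightarrow> 'a set \<Rightarrow> bool" where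
  "boundedly_presented G S \<longleftrightarrow> (\<exists>R n. is_presentation G S R \<and> (\<forall>r\<in>R. length r \<le> n))"

definition compactly_presented :: "('a, 'm) monoid_scheme \<Rightarrow> 'a topology \<Rightarrow> bool" where
  "compactly_presented G X \<longleftrightarrow>
    Hausdorff_space X \<and> (\<exists>S. compactin X S \<and> boundedly_presented G S)"

section \<open>Well-definedness\<close>

lemma inv_letter_inv_letter [simp]: "inv_letter (inv_letter x) = x"
  by (simp add: inv_letter_def)

lemma inv_letter_neq [simp]: "inv_letter x \<noteq> x" "x \<noteq> inv_letter x"
  by (cases x; simp add: inv_letter_def)+

lemma fst_inv_letter [simp]: "fst (inv_letter x) = fst x"
  by (simp add: inv_letter_def)

lemma reduced_Nil [simp]: "reduced []"
  by (simp add: reduced_def)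

lemma reduced_ConsD: "reduced (x # w) \<Longrightarrow> reduced w"
  by (cases w) (auto simp: reduced_def)

lemma reduced_reduced_Cons [simp]: "reduced w \<Longrightarrow> reduced (reduced_Cons x w)"
  by (cases w) (auto simp: reduced_def dest: reduced_ConsD[unfolded reduced_def])

lemma reduced_foldr [simp]: "reduced v \<Longrightarrow> reduced (foldr reduced_Cons u v)"
  by (induction u) auto

lemma reduced_reduce [simp]: "reduced (reduce w)"
  by (simp add: reduce_def)

lemma reduced_Cons_cancel:
  "reduced w \<Longrightarrow> reduced_Cons x (reduced_Cons (inv_letter x) w) = w"
  "reduced w \<Longrightarrow> reduced_Cons (inv_letter x) (reduced_Cons x w) = w"
  by (induction w rule: induct_list012; force simp: reduced_def)+

lemma set_reduced_Cons: "set (reduced_Cons x w) \<subseteq> insert x (set w)"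
  by (cases w) auto

lemma set_reduce: "set (reduce w) \<subseteq> set w"
  unfolding reduce_def
proof (induction w)
  case (Cons x w)
  then show ?case using set_reduced_Cons[of x "foldr reduced_Cons w []"] by auto
qed simp

lemma reduce_id: "reduced w \<Longrightarrow> reduce w = w"
proof (induction w)
  case (Cons x w)
  then show ?case
    by (cases w) (auto simp: reduce_def reduced_def dest: reduced_ConsD)
qed (simp add: reduce_def)

lemma foldr_reduced_Cons:
  "reduced u \<Longrightarrow> reduced v \<Longrightarrow>
    foldr reduced_Cons (reduced_Cons x u) v = reduced_Cons x (foldr reduced_Cons u v)"
  by (cases u) (auto simp: reduced_Cons_cancel dest: reduced_ConsD)

lemma foldr_reduce: "reduced v \<Longrightarrow> foldr reduced_Cons (reduce u) v = foldr reduced_Cons u v"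
proof (induction u)
  case (Cons x u)
  then show ?case
    using foldr_reduced_Cons[OF reduced_reduce[of u] Cons.prems] by (simp add: reduce_def)
qed (simp add: reduce_def)

lemma reduce_append: "reduce (u @ v) = foldr reduced_Cons u (reduce v)"
  by (simp add: reduce_def)

lemma reduce_reduce_append:
  "reduce (reduce u @ v) = reduce (u @ v)" "reduce (u @ reduce v) = reduce (u @ v)"
  by (simp_all add: reduce_append foldr_reduce reduce_id)

lemma foldr_reduced_Cons_inverse:
  "reduced v \<Longrightarrow> foldr reduced_Cons (map inv_letter (rev w)) (foldr reduced_Cons w v) = v"
  by (induction w arbitrary: v) (auto simp: reduced_Cons_cancel)

lemma reduce_inverse: "reduce (map inv_letter (rev w) @ w) = []"
  using foldr_reduced_Cons_inverse[of "[]" w] by (simp add: reduce_def)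

lemma group_free_group: "group (free_group S)"
proof (rule groupI)
  fix u v assume "u \<in> carrier (free_group S)" "v \<in> carrier (free_group S)"
  then show "u \<otimes>\<^bsub>free_group S\<^esub> v \<in> carrier (free_group S)"
    using set_reduce[of "u @ v"] by (force simp: free_group_def)
next
  fix u assume u: "u \<in> carrier (free_group S)"
  let ?v = "reduce (map inv_letter (rev u))"
  have "?v \<in> carrier (free_group S)"
    using u set_reduce[of "map inv_letter (rev u)"] by (force simp: free_group_def)
  moreover have "?v \<otimes>\<^bsub>free_group S\<^esub> u = \<one>\<^bsub>free_group S\<^esub>"
    by (simp add: free_group_def reduce_reduce_append reduce_inverse)
  ultimately show "\<exists>v\<in>carrier (free_group S). v \<otimes>\<^bsub>free_group S\<^esub> u = \<one>\<^bsub>free_group S\<^esub>"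
    by blast
qed (auto simp: free_group_def reduce_reduce_append reduce_id)

context group
begin

lemma list_prod_simps [simp]:
  "list_prod G [] = \<one>" "list_prod G (x # ws) = x \<otimes> list_prod G ws"
  by (simp_all add: list_prod_def)

lemma list_prod_closed [simp]: "set ws \<subseteq> carrier G \<Longrightarrow> list_prod G ws \<in> carrier G"
  by (induction ws) auto

lemma list_prod_append:
  "set us \<subseteq> carrier G \<Longrightarrow> set vs \<subseteq> carrier G \<Longrightarrow>
    list_prod G (us @ vs) = list_prod G us \<otimes> list_prod G vs"
  by (induction us) (auto simp: m_assoc)

lemma list_prod_rev_inv:
  "set ws \<subseteq> carrier G \<Longrightarrow> list_prod G (rev (map (m_inv G) ws)) = inv (list_prod G ws)"
proof (induction ws)
  case (Cons x ws)
  then have "set (rev (map (m_inv G) ws)) \<subseteq> carrier G" by auto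
  with Cons show ?case
    using list_prod_append[of "rev (map (m_inv G) ws)" "[inv x]"] by (simp add: inv_mult_group)
qed simp

lemma letter_value_closed [simp]: "fst l \<in> carrier G \<Longrightarrow> letter_value G l \<in> carrier G"
  by (simp add: letter_value_def)

lemma letter_value_inv_letter:
  "fst l \<in> carrier G \<Longrightarrow> letter_value G (inv_letter l) = inv (letter_value G l)"
  by (simp add: letter_value_def inv_letter_def)

lemma word_value_simps [simp]:
  "word_value G [] = \<one>" "word_value G (x # w) = letter_value G x \<otimes> word_value G w"
  by (simp_all add: word_value_def)

lemma word_value_closed [simp]: "fst ` set w \<subseteq> carrier G \<Longrightarrow> word_value G w \<in> carrier G"
  by (induction w) auto

lemma word_value_append:
  "fst ` set u \<subseteq> carrier G \<Longrightarrow> fst ` set v \<subseteq> carrier G \<Longrightarrow>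
    word_value G (u @ v) = word_value G u \<otimes> word_value G v"
  by (induction u) (auto simp: m_assoc)

lemma word_value_reduced_Cons:
  "fst x \<in> carrier G \<Longrightarrow> fst ` set w \<subseteq> carrier G \<Longrightarrow>
    word_value G (reduced_Cons x w) = letter_value G x \<otimes> word_value G w"
  by (cases w) (auto simp: letter_value_inv_letter m_assoc[symmetric])

lemma word_value_reduce:
  "fst ` set w \<subseteq> carrier G \<Longrightarrow> word_value G (reduce w) = word_value G w"
proof (induction w)
  case (Cons x w)
  have "fst ` set (reduce w) \<subseteq> carrier G"
    using Cons.prems set_reduce[of w] by auto
  with Cons show ?case
    using word_value_reduced_Cons[of x "reduce w"] by (simp add: reduce_def)
qed (simp add: reduce_def)

lemma word_value_hom:
  assumes "S \<subseteq> carrier G"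
  shows "word_value G \<in> hom (free_group S) G"
proof (rule homI)
  fix u assume "u \<in> carrier (free_group S)"
  then show "word_value G u \<in> carrier G"
    using assms by (auto simp: free_group_def intro!: word_value_closed)
next
  fix u v assume "u \<in> carrier (free_group S)" "v \<in> carrier (free_group S)"
  then have "fst ` set u \<subseteq> carrier G" "fst ` set v \<subseteq> carrier G"
    using assms by (auto simp: free_group_def)
  then show "word_value G (u \<otimes>\<^bsub>free_group S\<^esub> v) = word_value G u \<otimes> word_value G v"
    using word_value_reduce[of "u @ v"] by (auto simp: free_group_def word_value_append)
qed

lemma ex_list_prod:
  assumes "S \<subseteq> carrier G" "g \<in> generate G S"
  shows "\<exists>ws. set ws \<subseteq> S \<union> set_inv S \<and> list_prod G ws = g"
  using assms(2)
proof (induction rule: generate.induct)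
  case one
  show ?case by (rule exI[of _ "[]"]) simp
next
  case (incl h)
  then show ?case using assms(1) by (intro exI[of _ "[h]"]) auto
next
  case (inv h)
  then show ?case using assms(1) by (intro exI[of _ "[inv h]"]) (auto simp: SET_INV_def)
next
  case (eng h k)
  then obtain us vs where uv: "set us \<subseteq> S \<union> set_inv S" "list_prod G us = h"
    "set vs \<subseteq> S \<union> set_inv S" "list_prod G vs = k" by blast
  moreover have "S \<union> set_inv S \<subseteq> carrier G" using assms(1) by (auto simp: SET_INV_def)
  ultimately show ?case
    by (intro exI[of _ "us @ vs"]) (use list_prod_append[of us vs] in auto)
qed

lemma word_dist_le:
  assumes "g \<in> carrier G" "h \<in> carrier G" "set ws \<subseteq> S \<union> set_inv S" 
    "list_prod G ws = inv g \<otimes> h"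
  shows "word_dist G S g h \<le> length ws"
  using assms unfolding word_dist_def by (auto intro!: Least_le)

lemma word_dist_witness:
  assumes "S \<subseteq> carrier G" "generate G S = carrier G" "g \<in> carrier G" "h \<in> carrier G"
  obtains ws where "set ws \<subseteq> S \<union> set_inv S" "list_prod G ws = inv g \<otimes> h"
    "word_dist G S g h = length ws"
proof -
  let ?P = "\<lambda>n. \<exists>ws. length ws = n \<and> set ws \<subseteq> S \<union> set_inv S \<and> list_prod G ws = inv g \<otimes> h"
  have "\<exists>n. ?P n" using ex_list_prod[of S "inv g \<otimes> h"] assms by auto
  then have "?P (LEAST n. ?P n)" by (rule LeastI_ex)
  then show thesis using that assms(3,4) unfolding word_dist_def by auto
qed

lemma Metric_space_word_dist:
  assumes S: "S \<subseteq> carrier G" "generate G S = carrier G"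
  shows "Metric_space (carrier G) (word_dist G S)"
proof
  have sub: "S \<union> set_inv S \<subseteq> carrier G" using S(1) by (auto simp: SET_INV_def)
  have sym: "word_dist G S y x \<le> word_dist G S x y"
    if xy: "x \<in> carrier G" "y \<in> carrier G" for x y
  proof -
    obtain ws where ws: "set ws \<subseteq> S \<union> set_inv S" "list_prod G ws = inv x \<otimes> y"
      "word_dist G S x y = length ws" using word_dist_witness[OF S xy] .
    have "set (rev (map (m_inv G) ws)) \<subseteq> S \<union> set_inv S"
    proof -
      have "inv v \<in> S \<union> set_inv S" if "v \<in> S \<union> set_inv S" for v
        using that S(1) by (auto simp: SET_INV_def)
      then show ?thesis using ws(1) by auto
    qed
    moreover have "list_prod G (rev (map (m_inv G) ws)) = inv y \<otimes> x"
      using list_prod_rev_inv[OF subset_trans[OF ws(1) sub]] ws(2) xy by (simp add: inv_mult_group)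
    ultimately show ?thesis
      using word_dist_le[OF xy(2) xy(1), of "rev (map (m_inv G) ws)" S] ws(3) by simp
  qed
  show "0 \<le> word_dist G S x y" for x y by (simp add: word_dist_def)
  show "word_dist G S x y = word_dist G S y x" for x y
  proof (cases "x \<in> carrier G \<and> y \<in> carrier G")
    case True
    then show ?thesis using sym by (meson order_antisym)
  qed (auto simp: word_dist_def)
  show "word_dist G S x y = 0 \<longleftrightarrow> x = y" if xy: "x \<in> carrier G" "y \<in> carrier G" for x y
  proof
    assume 0: "word_dist G S x y = 0"
    obtain ws where "set ws \<subseteq> S \<union> set_inv S" "list_prod G ws = inv x \<otimes> y"
      "word_dist G S x y = length ws" using word_dist_witness[OF S xy] .
    with 0 have "inv x \<otimes> y = \<one>" by simp
    then show "x = y" using xy by (metis inv_equality inv_inv inv_closed)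
  next
    assume "x = y"
    then show "word_dist G S x y = 0"
      using word_dist_le[of x y "[]" S] xy by (simp add: word_dist_def)
  qed
  show "word_dist G S x z \<le> word_dist G S x y + word_dist G S y z"
    if xyz: "x \<in> carrier G" "y \<in> carrier G" "z \<in> carrier G" for x y z
  proof -
    obtain us where us: "set us \<subseteq> S \<union> set_inv S" "list_prod G us = inv x \<otimes> y"
      "word_dist G S x y = length us" using word_dist_witness[OF S xyz(1) xyz(2)] .
    obtain vs where vs: "set vs \<subseteq> S \<union> set_inv S" "list_prod G vs = inv y \<otimes> z"
      "word_dist G S y z = length vs" using word_dist_witness[OF S xyz(2) xyz(3)] .
    have "list_prod G (us @ vs) = (inv x \<otimes> y) \<otimes> (inv y \<otimes> z)"
      using us(1,2) vs(1,2) sub list_prod_append[of us vs] by (simp add: subset_trans)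
    also have "\<dots> = inv x \<otimes> z"
      using xyz by (metis inv_closed m_assoc m_closed r_inv r_one)
    finally have "list_prod G (us @ vs) = inv x \<otimes> z" .
    then show ?thesis
      using word_dist_le[of x z "us @ vs" S] us(1,3) vs(1,3) xyz by simp
  qed
qed

lemma word_metric_simps:
  assumes "S \<subseteq> carrier G" "generate G S = carrier G"
  shows "mspace (word_metric G S) = carrier G" "mdist (word_metric G S) = word_dist G S"
  using Metric_space_word_dist[OF assms]
  by (simp_all add: word_metric_def Metric_space.mspace_metric Metric_space.mdist_metric)

end

end

theory Submission
  imports Defs
begin

text \<open>By the Baire category theorem, compact sets are bounded in the word metric of any compact
  generating set, so all of these metrics are equivalent and only the combinatorics of words
  matters. Let \<open>G\<close> be boundedly presented and let \<open>Q\<close> be the quotient of the free group on \<open>T\<close> by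
  the relators of length at most \<open>L\<close> that hold in \<open>H\<close>. The projection \<open>p\<close> from \<open>Q\<close> to \<open>H\<close> is
  injective at scale \<open>L\<close>, so it behaves like a covering map: the image under the quasi-isometry
  \<open>f\<close> of a path in \<open>G\<close> has a unique lift to \<open>Q\<close> with short steps. Relators of \<open>G\<close> lift to closed
  paths, so \<open>f\<close> lifts to a map \<open>f'\<close> from \<open>G\<close> to \<open>Q\<close>. With the quasi-inverse \<open>g\<close>, correcting
  \<open>f' (g h)\<close> by the short lift of its distance to \<open>h\<close> gives a map \<open>r\<close> from \<open>H\<close> to \<open>Q\<close> such that
  \<open>r (h * p q) = r h * q\<close>. Hence \<open>p q = 1\<close> implies \<open>q = 1\<close>, and the short relators
  present \<open>H\<close>.\<close>

section \<open>Word balls\<close>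

definition word_ball :: "('a, 'm) monoid_scheme \<Rightarrow> 'a set \<Rightarrow> nat \<Rightarrow> 'a set" where
  "word_ball G S n = word_value G ` {w. fst ` set w \<subseteq> S \<and> length w \<le> n}"

definition inv_word :: "'a letter list \<Rightarrow> 'a letter list" where
  "inv_word w = rev (map inv_letter w)"

lemma length_inv_word [simp]: "length (inv_word w) = length w"
  by (simp add: inv_word_def)

lemma fst_set_inv_word [simp]: "fst ` set (inv_word w) = fst ` set w"
  by (force simp: inv_word_def image_image)

lemma length_reduced_Cons: "length (reduced_Cons x w) \<le> Suc (length w)"
  by (cases w) auto

lemma length_reduce: "length (reduce w) \<le> length w"
proof (induction w)
  case (Cons x w)
  then show ?case
    using length_reduced_Cons[of x "reduce w"] by (simp add: reduce_def)
qed (simp add: reduce_def)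

lemma fst_set_reduce: "fst ` set w \<subseteq> S \<Longrightarrow> fst ` set (reduce w) \<subseteq> S"
  using set_reduce[of w] by blast

lemma reduce_in_free_group: "fst ` set w \<subseteq> S \<Longrightarrow> reduce w \<in> carrier (free_group S)"
  using fst_set_reduce[of w S] by (simp add: free_group_def)

lemma mult_free_group: "u \<otimes>\<^bsub>free_group S\<^esub> v = reduce (u @ v)"
  by (simp add: free_group_def)

lemma one_free_group: "\<one>\<^bsub>free_group S\<^esub> = []"
  by (simp add: free_group_def)

lemma word_ballI:
  "fst ` set w \<subseteq> S \<Longrightarrow> length w \<le> n \<Longrightarrow> word_value G w \<in> word_ball G S n"
  by (auto simp: word_ball_def)

lemma word_ballE:
  assumes "x \<in> word_ball G S n"
  obtains w where "fst ` set w \<subseteq> S" "length w \<le> n" "word_value G w = x"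
  using assms by (auto simp: word_ball_def)

lemma word_ball_mono: "m \<le> n \<Longrightarrow> word_ball G S m \<subseteq> word_ball G S n"
  by (auto simp: word_ball_def)

context group
begin

lemma inv_mult_cancel:
  assumes "x \<in> carrier G" "y \<in> carrier G"
  shows "x \<otimes> (inv x \<otimes> y) = y" "inv x \<otimes> (x \<otimes> y) = y"
  using assms by (simp_all add: m_assoc[symmetric])

lemma word_value_inv_word:
  "fst ` set w \<subseteq> carrier G \<Longrightarrow> word_value G (inv_word w) = inv (word_value G w)"
proof (induction w)
  case (Cons l w)
  have "word_value G (inv_word w @ [inv_letter l]) = inv (word_value G w) \<otimes> inv (letter_value G l)"
    using Cons by (subst word_value_append) (auto simp: letter_value_inv_letter)
  with Cons show ?case
    by (simp add: inv_word_def inv_mult_group)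
qed (simp add: inv_word_def)

lemma word_ball_closed: "S \<subseteq> carrier G \<Longrightarrow> word_ball G S n \<subseteq> carrier G"
  by (auto simp: word_ball_def intro!: word_value_closed)

lemma word_ball_mult:
  assumes "S \<subseteq> carrier G" "x \<in> word_ball G S m" "y \<in> word_ball G S n"
  shows "x \<otimes> y \<in> word_ball G S (m + n)"
proof -
  obtain u v where uv: "fst ` set u \<subseteq> S" "length u \<le> m" "word_value G u = x"
    "fst ` set v \<subseteq> S" "length v \<le> n" "word_value G v = y"
    using assms(2,3) by (elim word_ballE)
  then have "word_value G (u @ v) = x \<otimes> y"
    using word_value_append[of u v] assms(1) by blast
  with uv show ?thesis
    using word_ballI[of "u @ v" S "m + n" G] by (auto simp: image_Un)
qed

lemma word_ball_inv:
  assumes "S \<subseteq> carrier G" "x \<in> word_ball G S n"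
  shows "inv x \<in> word_ball G S n"
proof -
  obtain w where w: "fst ` set w \<subseteq> S" "length w \<le> n" "word_value G w = x"
    using assms(2) by (elim word_ballE)
  then have "word_value G (inv_word w) = inv x"
    using assms(1) word_value_inv_word by blast
  with w show ?thesis
    using word_ballI[of "inv_word w" S n G] by simp
qed

lemma letter_value_word_ball:
  assumes "S \<subseteq> carrier G" "S \<subseteq> word_ball G S' m" "S' \<subseteq> carrier G" "fst l \<in> S"
  shows "letter_value G l \<in> word_ball G S' m"
  using assms word_ball_inv[OF assms(3)] by (auto simp: letter_value_def)

lemma subset_word_ball: "S \<subseteq> carrier G \<Longrightarrow> S \<subseteq> word_ball G S 1"
proof
  fix s assume "S \<subseteq> carrier G" "s \<in> S"
  then show "s \<in> word_ball G S 1"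
    using word_ballI[of "[(s, True)]" S 1 G] by (auto simp: letter_value_def)
qed

text \<open>Each letter is replaced by a word of length at most \<open>m\<close> over
  \<open>S'\<close>. This makes estimates over two mutually bounded generating sets
  interchangeable.\<close>

lemma word_ball_subset_word_ball:
  assumes "S \<subseteq> carrier G" "S' \<subseteq> carrier G" "S \<subseteq> word_ball G S' m"
  shows "word_ball G S n \<subseteq> word_ball G S' (n * m)"
proof
  fix x assume "x \<in> word_ball G S n"
  then obtain w where w: "fst ` set w \<subseteq> S" "length w \<le> n" "word_value G w = x"
    by (elim word_ballE)
  have "word_value G w \<in> word_ball G S' (length w * m)"
    using w(1)
  proof (induction w)
    case Nil
    show ?case using word_ballI[of "[]" S' 0 G] by simp
  next
    case (Cons l w)
    then have "letter_value G l \<in> word_ball G S' m" "word_value G w \<in> word_ball G S' (length w * m)"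
      using letter_value_word_ball[OF assms(1,3,2), of l] by auto
    then show ?case
      using word_ball_mult[OF assms(2)] by simp
  qed
  then show "x \<in> word_ball G S' (n * m)"
    using w word_ball_mono[of "length w * m" "n * m" G S'] by auto
qed

lemma ex_letters:
  assumes "S \<subseteq> carrier G" "set ws \<subseteq> S \<union> set_inv S"
  shows "\<exists>w. fst ` set w \<subseteq> S \<and> length w = length ws \<and> word_value G w = list_prod G ws"
  using assms(2)
proof (induction ws)
  case (Cons x ws)
  then obtain w where w: "fst ` set w \<subseteq> S" "length w = length ws" "word_value G w = list_prod G ws"
    by auto
  from Cons.prems obtain l where "fst l \<in> S" "letter_value G l = x"
    using assms(1) that[of "(x, True)"] that[of "(inv x, False)"]
    by (auto simp: SET_INV_def letter_value_def)
  with w show ?case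
    by (intro exI[of _ "l # w"]) auto
qed simp

lemma carrier_eq_word_value:
  assumes "S \<subseteq> carrier G" "generate G S = carrier G" "x \<in> carrier G"
  obtains w where "fst ` set w \<subseteq> S" "word_value G w = x"
  using ex_list_prod[of S x] ex_letters[of S] assms by metis

lemma carrier_word_ball:
  assumes "S \<subseteq> carrier G" "generate G S = carrier G" "x \<in> carrier G"
  shows "\<exists>n. x \<in> word_ball G S n"
  using carrier_eq_word_value[OF assms] word_ballI[OF _ order_refl] by metis

lemma word_value_generate: "S \<subseteq> carrier G \<Longrightarrow> fst ` set w \<subseteq> S \<Longrightarrow> word_value G w \<in> generate G S"
proof (induction w)
  case (Cons l w)
  have "letter_value G l \<in> generate G S"
    using Cons.prems by (auto simp: letter_value_def intro: generate.incl generate.inv)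
  with Cons show ?case by (simp add: generate.eng)
qed (simp add: generate.one)

text \<open>The bridge from metric estimates to words: after this, only membership of displacements
  in balls of integer radius is used.\<close>

lemma word_dist_le_iff:
  assumes S: "S \<subseteq> carrier G" "generate G S = carrier G" and xy: "x \<in> carrier G" "y \<in> carrier G"
  shows "word_dist G S x y \<le> real n \<longleftrightarrow> inv x \<otimes> y \<in> word_ball G S n"
proof
  assume le: "word_dist G S x y \<le> real n"
  obtain ws where ws: "set ws \<subseteq> S \<union> set_inv S" "list_prod G ws = inv x \<otimes> y"
    "word_dist G S x y = length ws" using word_dist_witness[OF S xy] .
  obtain w where "fst ` set w \<subseteq> S" "length w = length ws" "word_value G w = list_prod G ws"
    using ex_letters[OF S(1) ws(1)] by blast
  then show "inv x \<otimes> y \<in> word_ball G S n"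
    using le ws word_ballI[of w S n G] by simp
next
  assume "inv x \<otimes> y \<in> word_ball G S n"
  then obtain w where w: "fst ` set w \<subseteq> S" "length w \<le> n" "word_value G w = inv x \<otimes> y"
    by (elim word_ballE)
  have "letter_value G l \<in> S \<union> set_inv S" if "fst l \<in> S" for l
    using that by (auto simp: letter_value_def SET_INV_def)
  with w(1) have "set (map (letter_value G) w) \<subseteq> S \<union> set_inv S"
    by auto
  from word_dist_le[OF xy this] w show "word_dist G S x y \<le> real n"
    by (simp add: word_value_def)
qed

end


section \<open>Compact subsets are bounded\<close>

context topological_group
begin

lemma compactin_subset_carrier: "compactin X K \<Longrightarrow> K \<subseteq> carrier G"
  using compactin_subset_topspace topspace_eq by metis

lemma continuous_map_mult:
  assumes "continuous_map Z X f" "continuous_map Z X g"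
  shows "continuous_map Z X (\<lambda>z. f z \<otimes> g z)"
  using continuous_map_compose[OF continuous_map_pairedI[OF assms] continuous_mult]
  by (simp add: o_def)

lemma compactin_mult:
  assumes "compactin X A" "compactin X B"
  shows "compactin X ((\<lambda>(x, y). x \<otimes> y) ` (A \<times> B))"
  using assms continuous_mult by (intro image_compactin) (auto simp: compactin_Times)

text \<open>By induction: a ball is the image under multiplication of a compact set of letters times
  the previous ball.\<close>

lemma compactin_word_ball:
  assumes "compactin X S"
  shows "compactin X (word_ball G S n)"
proof (induction n)
  case 0
  have "word_ball G S 0 = {\<one>}" by (auto simp: word_ball_def)
  then show ?case using topspace_eq by simp
next
  case (Suc n)
  have S: "S \<subseteq> carrier G"
    using compactin_subset_carrier[OF assms] .
  \<comment> \<open>The identity is included for the empty word, which has no first letter to split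
    off.\<close>
  let ?U = "insert \<one> (S \<union> (\<lambda>x. inv x) ` S)"
  have "word_ball G S (Suc n) = (\<lambda>(x, y). x \<otimes> y) ` (?U \<times> word_ball G S n)" (is "?L = ?R")
  proof
    show "?L \<subseteq> ?R"
    proof
      fix x assume "x \<in> ?L"
      then obtain w where w: "fst ` set w \<subseteq> S" "length w \<le> Suc n" "word_value G w = x"
        by (elim word_ballE)
      show "x \<in> ?R"
      proof (cases w)
        case Nil
        then have "x = \<one>" using w by simp
        then show ?thesis
          using word_ballI[of "[]" S n G] by (intro image_eqI[of _ _ "(\<one>, word_value G [])"]) auto
      next
        case (Cons l v)
        then have "letter_value G l \<in> ?U" "word_value G v \<in> word_ball G S n"
          using w word_ballI[of v S n G] by (auto simp: letter_value_def)
        then show ?thesis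
          using w Cons by (intro image_eqI[of _ _ "(letter_value G l, word_value G v)"]) auto
      qed
    qed
    have U: "u \<in> word_ball G S 1" if u: "u \<in> ?U" for u
    proof -
      consider "u = \<one>" | "u \<in> S" | s where "s \<in> S" "u = inv s"
        using u by blast
      then show ?thesis
      proof cases
        case 1
        then show ?thesis using word_ballI[of "[]" S 1 G] by simp
      next
        case 2
        then show ?thesis using subset_word_ball[OF S] by blast
      next
        case 3
        then show ?thesis using subset_word_ball[OF S] word_ball_inv[OF S] by blast
      qed
    qed
    show "?R \<subseteq> ?L"
    proof
      fix z assume "z \<in> ?R"
      then obtain p where p: "p \<in> ?U \<times> word_ball G S n" "z = (\<lambda>(x, y). x \<otimes> y) p"
        by (rule imageE)
      then have "fst p \<in> ?U" "snd p \<in> word_ball G S n" "z = fst p \<otimes> snd p"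
        unfolding mem_Times_iff case_prod_beta by simp_all
      then show "z \<in> ?L"
        using word_ball_mult[OF S U, of "fst p" "snd p" n] by simp
    qed
  qed
  moreover have "compactin X ?U"
  proof -
    have "compactin X ({\<one>} \<union> (S \<union> (\<lambda>x. inv x) ` S))"
      using assms image_compactin[OF assms continuous_inv] topspace_eq
      by (intro compactin_Un) auto
    then show ?thesis by simp
  qed
  ultimately show ?case using compactin_mult[OF _ Suc] by metis
qed

lemma openin_left_translate:
  assumes "openin X U" "a \<in> carrier G"
  shows "openin X {x \<in> carrier G. a \<otimes> x \<in> U}"
  using openin_continuous_map_preimage[OF continuous_map_mult[of X "\<lambda>_. a" "\<lambda>x. x"] assms(1)]
    assms(2) topspace_eq by simp

end

context locally_compact_group
begin

text \<open>Balls are compact, hence closed in a Hausdorff space, and countably many of them cover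
  the group. If all had empty interior, so would the whole nonempty space, against the Baire
  category theorem for locally compact Hausdorff spaces.\<close>

lemma word_ball_interior:
  assumes "compact_generating_set G X S"
  obtains n where "X interior_of (word_ball G S n) \<noteq> {}"
proof (rule ccontr)
  assume "\<not> thesis"
  with that have empty: "X interior_of (word_ball G S n) = {}" for n by blast
  have S: "compactin X S" "generate G S = carrier G"
    using assms by (auto simp: compact_generating_set_def)
  then have sub: "S \<subseteq> carrier G"
    using compactin_subset_carrier by blast
  have closed: "closedin X (word_ball G S n)" for n
    using compactin_imp_closedin[OF Hausdorff compactin_word_ball[OF S(1)]] .
  have "X interior_of \<Union> (range (word_ball G S)) = {}"
  proof (rule Baire_category_alt)
    show "completely_metrizable_space X \<or> locally_compact_space X \<and> regular_space X"
      using locally_compact Hausdorff locally_compact_Hausdorff_imp_regular_space by blast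
    show "closedin X B \<and> X interior_of B = {}" if "B \<in> range (word_ball G S)" for B
      using that closed empty by auto
  qed simp
  moreover have "\<Union> (range (word_ball G S)) = topspace X"
  proof
    show "\<Union> (range (word_ball G S)) \<subseteq> topspace X"
      using word_ball_closed[OF sub] by (auto simp: topspace_eq)
    show "topspace X \<subseteq> \<Union> (range (word_ball G S))"
      using carrier_word_ball[OF sub S(2)] by (auto simp: topspace_eq)
  qed
  ultimately have "topspace X = {}"
    by (metis interior_of_topspace)
  then show False
    using topspace_eq one_closed by auto
qed

text \<open>One ball has an interior point \<open>a\<close>. Translates of that interior cover
  \<open>K\<close>, finitely many suffice, and each translate lies in some ball.\<close>

lemma compactin_subset_word_ball:
  assumes "compact_generating_set G X S" "compactin X K"
  obtains n where "K \<subseteq> word_ball G S n"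
proof -
  have S: "compactin X S" "generate G S = carrier G" "S \<subseteq> carrier G"
    using assms(1) compactin_subset_carrier by (simp_all add: compact_generating_set_def)
  have K: "K \<subseteq> carrier G"
    using compactin_subset_carrier[OF assms(2)] .
  obtain n where "X interior_of (word_ball G S n) \<noteq> {}"
    using word_ball_interior[OF assms(1)] .
  then obtain a where a: "a \<in> X interior_of (word_ball G S n)" by blast
  have int: "X interior_of (word_ball G S n) \<subseteq> word_ball G S n"
    by (rule interior_of_subset)
  with a have aG: "a \<in> carrier G" "a \<in> word_ball G S n"
    using word_ball_closed[OF S(3), of n] by auto
  \<comment> \<open>\<open>W k\<close> is the interior translated so that \<open>a\<close> moves to
    \<open>k\<close>; it is an open neighbourhood of \<open>k\<close>.\<close>
  define W where "W k = {x \<in> carrier G. (a \<otimes> inv k) \<otimes> x \<in> X interior_of (word_ball G S n)}" for k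
  have "openin X (W k)" if "k \<in> K" for k
    unfolding W_def using that K aG by (intro openin_left_translate) auto
  moreover have "k \<in> W k" if "k \<in> K" for k
    using that K a aG by (auto simp: W_def m_assoc subset_iff)
  ultimately have "\<forall>U\<in>W ` K. openin X U" "K \<subseteq> \<Union> (W ` K)"
    by blast+
  then have "\<exists>\<F>. finite \<F> \<and> \<F> \<subseteq> W ` K \<and> K \<subseteq> \<Union>\<F>"
    using assms(2) unfolding compactin_def by presburger
  then obtain \<F> where F: "finite \<F>" "\<F> \<subseteq> W ` K" "K \<subseteq> \<Union>\<F>"
    by blast
  then obtain J where J: "finite J" "J \<subseteq> K" "\<F> = W ` J"
    by (meson finite_subset_image)
  have "\<exists>i. k \<in> word_ball G S i" if "k \<in> K" for k
    using carrier_word_ball[OF S(3,2)] that K by auto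
  then obtain i where i: "\<And>k. k \<in> K \<Longrightarrow> k \<in> word_ball G S (i k)" by metis
  \<comment> \<open>\<open>0\<close> is inserted because \<open>J\<close> may be empty.\<close>
  define M where "M = Max (insert 0 (i ` J))"
  \<comment> \<open>The three summands of the radius belong to the factors \<open>k\<close>,
    \<open>inv a\<close> and \<open>a \<otimes> inv k \<otimes> x\<close>, whose product is
    \<open>x\<close>.\<close>
  have "x \<in> word_ball G S (M + (n + n))" if x: "x \<in> K" for x
  proof -
    obtain k where k: "k \<in> J" "x \<in> W k"
      using x F(3) J(3) by blast
    then have kG: "k \<in> carrier G" and xG: "x \<in> carrier G"
      using J K W_def by auto
    have "i k \<le> M" using k(1) J(1) by (simp add: M_def)
    then have "k \<in> word_ball G S M"
      using i[of k] k(1) J(2) word_ball_mono[of "i k" M G S] by auto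
    moreover have "inv a \<in> word_ball G S n"
      using word_ball_inv[OF S(3) aG(2)] .
    moreover have "(a \<otimes> inv k) \<otimes> x \<in> word_ball G S n"
      using k(2) int by (auto simp: W_def)
    ultimately have "k \<otimes> (inv a \<otimes> ((a \<otimes> inv k) \<otimes> x)) \<in> word_ball G S (M + (n + n))"
      by (intro word_ball_mult[OF S(3)])
    moreover have "k \<otimes> (inv a \<otimes> ((a \<otimes> inv k) \<otimes> x)) = x"
      using kG xG aG(1) by (simp add: m_assoc inv_mult_cancel)
    ultimately show ?thesis by simp
  qed
  then show thesis using that by blast
qed

end


section \<open>Lifting\<close>

lemma (in group) normal_normal_closure:
  assumes "R \<subseteq> carrier G"
  shows "normal_closure G R \<lhd> G" "R \<subseteq> normal_closure G R"
proof -
  \<comment> \<open>The whole group shows that the family being intersected is nonempty, so that its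
    intersection is a subgroup.\<close>
  have "carrier G \<lhd> G"
    by (simp add: normal_inv_iff subgroup_self)
  then have ne: "{N. N \<lhd> G \<and> R \<subseteq> N} \<noteq> {}"
    using assms by blast
  have "subgroup (\<Inter>{N. N \<lhd> G \<and> R \<subseteq> N}) G"
    using ne by (intro subgroups_Inter) (auto simp: normal_inv_iff)
  then show "normal_closure G R \<lhd> G"
    unfolding normal_closure_def by (auto simp: normal_inv_iff)
  show "R \<subseteq> normal_closure G R"
    by (auto simp: normal_closure_def)
qed

lemma normal_closure_subset:
  "N \<lhd> G \<Longrightarrow> R \<subseteq> N \<Longrightarrow> normal_closure G R \<subseteq> N"
  by (auto simp: normal_closure_def)

lemma (in group_hom) hom_word_value:
  assumes "fst ` set w \<subseteq> carrier G"
  shows "h (word_value G w) = word_value H (map (map_prod h (\<lambda>b. b)) w)"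
  using assms
proof (induction w)
  case (Cons l w)
  then have "h (letter_value G l) = letter_value H (map_prod h (\<lambda>b. b) l)"
    by (auto simp: letter_value_def)
  with Cons show ?case by simp
qed simp

text \<open>Balls map onto balls of the same radius, so an element of the target ball has a preimage
  that is equally short. This provides the lifts of single steps.\<close>

lemma (in group_hom) word_ball_image:
  assumes "T \<subseteq> carrier G"
  shows "h ` word_ball G T n = word_ball H (h ` T) n"
proof (intro equalityI subsetI)
  fix y assume "y \<in> h ` word_ball G T n"
  then obtain x where x: "x \<in> word_ball G T n" "y = h x" by blast
  then obtain w where w: "fst ` set w \<subseteq> T" "length w \<le> n" "word_value G w = x"
    by (elim word_ballE)
  then have "y = word_value H (map (map_prod h (\<lambda>b. b)) w)"
    using hom_word_value[of w] x assms by auto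
  moreover have "fst ` set (map (map_prod h (\<lambda>b. b)) w) \<subseteq> h ` T"
    using w(1) by (auto simp: subset_iff)
  ultimately show "y \<in> word_ball H (h ` T) n"
    using word_ballI[of "map (map_prod h (\<lambda>b. b)) w" "h ` T" n H] w(2) by simp
next
  fix y assume "y \<in> word_ball H (h ` T) n"
  then obtain v where v: "fst ` set v \<subseteq> h ` T" "length v \<le> n" "word_value H v = y"
    by (elim word_ballE)
  \<comment> \<open>The word is lifted letter by letter: a preimage in \<open>T\<close> is chosen
    for each generator and its sign is kept.\<close>
  define w where "w = map (map_prod (inv_into T h) (\<lambda>b. b)) v"
  have "map_prod h (\<lambda>b. b) (map_prod (inv_into T h) (\<lambda>b. b) l) = l \<and> inv_into T h (fst l) \<in> T"
    if l: "l \<in> set v" for l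
  proof -
    have "fst l \<in> h ` T" using v(1) l by auto
    then show ?thesis by (cases l) (simp add: f_inv_into_f inv_into_into)
  qed
  then have "map (map_prod h (\<lambda>b. b)) w = v" "fst ` set w \<subseteq> T"
    by (auto simp: w_def intro!: map_idI)
  moreover have "length w \<le> n" using v(2) by (simp add: w_def)
  ultimately have "y = h (word_value G w)" "word_value G w \<in> word_ball G T n"
    using hom_word_value[of w] v(3) assms word_ballI[of w T n G] by auto
  then show "y \<in> h ` word_ball G T n" by blast
qed

section \<open>Lifting paths through a homomorphism that is injective at scale
  \<open>L\<close>\<close>

text \<open>\<open>f_Lipschitz\<close> says that \<open>f\<close> sends each edge of the Cayley
  graph of \<open>G\<close> to a displacement of length at most \<open>k\<close>, and
  \<open>p_inj\<close> that the kernel of \<open>p\<close> meets the ball of radius \<open>L\<close>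
  trivially. The bound \<open>2 * k \<le> L\<close> ensures that an edge traversed back and forth
  lifts to a closed path.\<close>

locale lifting = G: group G + p: group_hom Q H p
  for G :: "('a, 'm) monoid_scheme" and Q :: "('q, 'k) monoid_scheme"
    and H :: "('b, 'n) monoid_scheme" and p +
  fixes S :: "'a set" and T :: "'q set" and f :: "'a \<Rightarrow> 'b" and k L :: nat
  assumes S: "S \<subseteq> carrier G" and T: "T \<subseteq> carrier Q"
    and f_closed: "\<And>x. x \<in> carrier G \<Longrightarrow> f x \<in> carrier H"
    and f_Lipschitz: "\<And>x l. x \<in> carrier G \<Longrightarrow> fst l \<in> S \<Longrightarrow>
          inv\<^bsub>H\<^esub> f x \<otimes>\<^bsub>H\<^esub> f (x \<otimes>\<^bsub>G\<^esub> letter_value G l) \<in> word_ball H (p ` T) k"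
    and p_inj: "\<And>q. q \<in> word_ball Q T L \<Longrightarrow> p q = \<one>\<^bsub>H\<^esub> \<Longrightarrow> q = \<one>\<^bsub>Q\<^esub>"
    and L: "2 * k \<le> L"
begin

text \<open>For \<open>y\<close> in the ball of radius \<open>k\<close> the choice is in fact
  unique: two candidates differ by a kernel element of length at most \<open>2 * k \<le> L\<close>,
  which \<open>p_inj\<close> makes trivial.\<close>

definition short_lift :: "'b \<Rightarrow> 'q" where
  "short_lift y = (SOME q. q \<in> word_ball Q T k \<and> p q = y)"

lemma short_lift:
  assumes "y \<in> word_ball H (p ` T) k"
  shows "short_lift y \<in> word_ball Q T k" "p (short_lift y) = y" "short_lift y \<in> carrier Q"
proof -
  have "y \<in> p ` word_ball Q T k"
    using assms p.word_ball_image[OF T, of k] by simp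
  then have "\<exists>q. q \<in> word_ball Q T k \<and> p q = y"
    by blast
  from someI_ex[OF this] show *: "short_lift y \<in> word_ball Q T k" "p (short_lift y) = y"
    by (auto simp: short_lift_def)
  show "short_lift y \<in> carrier Q"
    using * p.G.word_ball_closed[OF T, of k] by auto
qed

text \<open>\<open>path_lift x w\<close> is the displacement of the lift to \<open>Q\<close> of the image under \<open>f\<close> of the
  path that starts at \<open>x\<close> and is labelled by \<open>w\<close>.\<close>

primrec path_lift :: "'a \<Rightarrow> 'a letter list \<Rightarrow> 'q" where
  "path_lift x [] = \<one>\<^bsub>Q\<^esub>"
| "path_lift x (l # w) = short_lift (inv\<^bsub>H\<^esub> f x \<otimes>\<^bsub>H\<^esub> f (x \<otimes>\<^bsub>G\<^esub> letter_value G l)) \<otimes>\<^bsub>Q\<^esub>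
     path_lift (x \<otimes>\<^bsub>G\<^esub> letter_value G l) w"

lemma path_lift_props:
  assumes "fst ` set w \<subseteq> S" "x \<in> carrier G"
  shows "path_lift x w \<in> word_ball Q T (length w * k) \<and> path_lift x w \<in> carrier Q \<and>
    p (path_lift x w) = inv\<^bsub>H\<^esub> f x \<otimes>\<^bsub>H\<^esub> f (x \<otimes>\<^bsub>G\<^esub> word_value G w)"
  using assms
proof (induction w arbitrary: x)
  case Nil
  then show ?case
    using word_ballI[of "[]" T 0 Q] f_closed by simp
next
  case (Cons l w)
  let ?x' = "x \<otimes>\<^bsub>G\<^esub> letter_value G l"
  have l: "fst l \<in> S" "fst l \<in> carrier G" and w: "fst ` set w \<subseteq> S" "fst ` set w \<subseteq> carrier G"
    using Cons.prems(1) S by auto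
  have x': "?x' \<in> carrier G"
    using l Cons.prems(2) by simp
  note IH = Cons.IH[OF w(1) x']
  note sl = short_lift[OF f_Lipschitz[OF Cons.prems(2) l(1)]]
  have "f x \<in> carrier H" "f ?x' \<in> carrier H"
    using f_closed x' Cons.prems(2) by auto
  \<comment> \<open>With this cancellation the displacements of consecutive edges telescope.\<close>
  then have "inv\<^bsub>H\<^esub> f x \<otimes>\<^bsub>H\<^esub> f ?x' \<otimes>\<^bsub>H\<^esub> (inv\<^bsub>H\<^esub> f ?x' \<otimes>\<^bsub>H\<^esub> z) = inv\<^bsub>H\<^esub> f x \<otimes>\<^bsub>H\<^esub> z"
    if "z \<in> carrier H" for z
    using that by (simp add: p.H.m_assoc p.H.inv_mult_cancel)
  moreover have "?x' \<otimes>\<^bsub>G\<^esub> word_value G w \<in> carrier G"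
    using x' w(2) by simp
  ultimately have "p (path_lift x (l # w)) = inv\<^bsub>H\<^esub> f x \<otimes>\<^bsub>H\<^esub> f (?x' \<otimes>\<^bsub>G\<^esub> word_value G w)"
    using sl IH f_closed by simp
  moreover have "?x' \<otimes>\<^bsub>G\<^esub> word_value G w = x \<otimes>\<^bsub>G\<^esub> word_value G (l # w)"
    using l w Cons.prems(2) by (simp add: G.m_assoc)
  moreover have "path_lift x (l # w) \<in> word_ball Q T (k + length w * k)"
    using p.G.word_ball_mult[OF T sl(1)] IH by simp
  ultimately show ?case
    using sl IH by simp
qed

lemmas path_lift_word_ball = path_lift_props[THEN conjunct1]
  and path_lift_closed = path_lift_props[THEN conjunct2, THEN conjunct1]
  and hom_path_lift = path_lift_props[THEN conjunct2, THEN conjunct2]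

text \<open>A cocycle rule: displacements multiply, but the second path has to be lifted from the
  endpoint of the first.\<close>

lemma path_lift_append:
  assumes "fst ` set u \<subseteq> S" "fst ` set v \<subseteq> S" "x \<in> carrier G"
  shows "path_lift x (u @ v) = path_lift x u \<otimes>\<^bsub>Q\<^esub> path_lift (x \<otimes>\<^bsub>G\<^esub> word_value G u) v"
  using assms
proof (induction u arbitrary: x)
  case Nil
  then show ?case using path_lift_closed by simp
next
  case (Cons l u)
  have l: "fst l \<in> S" "fst l \<in> carrier G" and u: "fst ` set u \<subseteq> S" "fst ` set u \<subseteq> carrier G"
    using Cons.prems(1) S by auto
  let ?x' = "x \<otimes>\<^bsub>G\<^esub> letter_value G l"
  have x': "?x' \<in> carrier G" "?x' \<otimes>\<^bsub>G\<^esub> word_value G u \<in> carrier G"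
    using l u Cons.prems(3) by simp_all
  have "path_lift ?x' (u @ v) = path_lift ?x' u \<otimes>\<^bsub>Q\<^esub> path_lift (?x' \<otimes>\<^bsub>G\<^esub> word_value G u) v"
    using Cons.IH[OF u(1) Cons.prems(2) x'(1)] .
  then show ?case
    using short_lift(3)[OF f_Lipschitz[OF Cons.prems(3) l(1)]] l u Cons.prems(3)
      path_lift_closed[OF u(1) x'(1)] path_lift_closed[OF Cons.prems(2) x'(2)]
    by (simp add: p.G.m_assoc G.m_assoc)
qed

text \<open>The image under \<open>f\<close> of a loop is closed, so the displacement of its lift
  lies in the kernel of \<open>p\<close>; its length is at most \<open>length w * k\<close>, within
  the scale of \<open>p_inj\<close>.\<close>

lemma path_lift_short_loop:
  assumes "fst ` set w \<subseteq> S" "x \<in> carrier G" "word_value G w = \<one>\<^bsub>G\<^esub>" "length w * k \<le> L"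
  shows "path_lift x w = \<one>\<^bsub>Q\<^esub>"
proof (rule p_inj)
  show "path_lift x w \<in> word_ball Q T L"
    using path_lift_word_ball[OF assms(1,2)] word_ball_mono[OF assms(4), of Q T] by blast
  show "p (path_lift x w) = \<one>\<^bsub>H\<^esub>"
    using hom_path_lift[OF assms(1,2)] assms(2,3) f_closed by simp
qed

text \<open>Free reduction only deletes backtracks \<open>[l, inv_letter l]\<close>. These are loops
  of length 2, so their lifts are trivial and the base point is unchanged.\<close>

lemma path_lift_reduce:
  assumes "fst ` set w \<subseteq> S" "x \<in> carrier G"
  shows "path_lift x (reduce w) = path_lift x w"
  using assms
proof (induction w arbitrary: x)
  case (Cons l w)
  have l: "fst l \<in> S" "fst l \<in> carrier G" and w: "fst ` set w \<subseteq> S"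
    using Cons.prems(1) S by auto
  let ?x' = "x \<otimes>\<^bsub>G\<^esub> letter_value G l"
  have x': "?x' \<in> carrier G"
    using l Cons.prems(2) by simp
  have "path_lift x (l # reduce w) = path_lift x (l # w)"
    using Cons.IH[OF w x'] by simp
  moreover have "path_lift x (reduced_Cons l v) = path_lift x (l # v)" if v: "fst ` set v \<subseteq> S" for v
  proof (cases "\<exists>v'. v = inv_letter l # v'")
    case True
    then obtain v' where v': "v = inv_letter l # v'" by blast
    let ?c = "[l, inv_letter l]"
    have c: "fst ` set ?c \<subseteq> S" "word_value G ?c = \<one>\<^bsub>G\<^esub>"
      using l by (auto simp: G.letter_value_inv_letter)
    have "path_lift x (?c @ v') = path_lift x ?c \<otimes>\<^bsub>Q\<^esub> path_lift (x \<otimes>\<^bsub>G\<^esub> word_value G ?c) v'"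
      using v v' by (intro path_lift_append c(1) Cons.prems(2)) auto
    moreover have "path_lift x ?c = \<one>\<^bsub>Q\<^esub>"
      using L by (intro path_lift_short_loop c Cons.prems(2)) simp
    ultimately have "path_lift x (?c @ v') = path_lift x v'"
      using v v' Cons.prems(2) path_lift_closed[of v' x] unfolding c(2) by simp
    then show ?thesis by (simp add: v')
  next
    case False
    then have "reduced_Cons l v = l # v" by (cases v) auto
    then show ?thesis by simp
  qed
  ultimately show ?case
    using fst_set_reduce[OF w] by (simp add: reduce_def)
qed (simp add: reduce_def)

text \<open>Loops in \<open>G\<close> are products of conjugates of relators, and these lift to closed paths
  because \<open>p\<close> is injective at the scale of the relators.\<close>

lemma path_lift_loop:
  assumes pres: "is_presentation G S R" and R: "\<And>r. r \<in> R \<Longrightarrow> length r * k \<le> L"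
    and w: "fst ` set w \<subseteq> S" "word_value G w = \<one>\<^bsub>G\<^esub>" and x: "x \<in> carrier G"
  shows "path_lift x w = \<one>\<^bsub>Q\<^esub>"
proof -
  let ?F = "free_group S"
  interpret F: group ?F by (rule group_free_group)
  interpret v: group_hom ?F G "word_value G"
    using G.word_value_hom[OF S] by unfold_locales
  \<comment> \<open>Triviality is required from every starting point, since conjugating a relator
    moves the point where it is read. Membership in the kernel brings the path back to that
    point.\<close>
  define N where "N = {u \<in> kernel ?F G (word_value G). \<forall>x\<in>carrier G. path_lift x u = \<one>\<^bsub>Q\<^esub>}"
  have inS: "fst ` set u \<subseteq> S" if "u \<in> carrier ?F" for u
    using that by (auto simp: free_group_def)
  have mult: "path_lift x (u \<otimes>\<^bsub>?F\<^esub> u') = path_lift x u \<otimes>\<^bsub>Q\<^esub> path_lift (x \<otimes>\<^bsub>G\<^esub> word_value G u) u'"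
    if "u \<in> carrier ?F" "u' \<in> carrier ?F" "x \<in> carrier G" for x u u'
    using path_lift_append[OF inS inS, of u u' x] path_lift_reduce[of "u @ u'" x] inS that
    by (auto simp: mult_free_group image_Un)
  have one: "path_lift x \<one>\<^bsub>?F\<^esub> = \<one>\<^bsub>Q\<^esub>" for x
    by (simp add: one_free_group)
  have N_sub: "subgroup N ?F"
  proof
    show "N \<subseteq> carrier ?F" by (auto simp: N_def kernel_def)
    show "\<one>\<^bsub>?F\<^esub> \<in> N" using one by (auto simp: N_def kernel_def)
    fix a b assume ab: "a \<in> N" "b \<in> N"
    then show "a \<otimes>\<^bsub>?F\<^esub> b \<in> N" using mult by (auto simp: N_def kernel_def)
    have a: "a \<in> carrier ?F" "word_value G a = \<one>\<^bsub>G\<^esub>" "inv\<^bsub>?F\<^esub> a \<in> carrier ?F"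
      "\<And>x. x \<in> carrier G \<Longrightarrow> path_lift x a = \<one>\<^bsub>Q\<^esub>"
      using ab by (auto simp: N_def kernel_def)
    have "path_lift x (inv\<^bsub>?F\<^esub> a) = \<one>\<^bsub>Q\<^esub>" if "x \<in> carrier G" for x
      using mult[OF a(1,3) that] a that one path_lift_closed[OF inS[OF a(3)] that] by simp
    then show "inv\<^bsub>?F\<^esub> a \<in> N" using a by (auto simp: N_def kernel_def)
  qed
  have "N \<lhd> ?F"
    unfolding F.normal_inv_iff
  proof (intro conjI N_sub ballI)
    fix a b assume a: "a \<in> carrier ?F" and b: "b \<in> N"
    then have b': "b \<in> carrier ?F" "word_value G b = \<one>\<^bsub>G\<^esub>"
      "\<And>x. x \<in> carrier G \<Longrightarrow> path_lift x b = \<one>\<^bsub>Q\<^esub>"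
      by (auto simp: N_def kernel_def)
    have va: "word_value G a \<in> carrier G" and a': "inv\<^bsub>?F\<^esub> a \<in> carrier ?F"
      using a by simp_all
    have "path_lift x (a \<otimes>\<^bsub>?F\<^esub> b \<otimes>\<^bsub>?F\<^esub> inv\<^bsub>?F\<^esub> a) = \<one>\<^bsub>Q\<^esub>" if x: "x \<in> carrier G" for x
    proof -
      \<comment> \<open>The loop \<open>b\<close> has trivial lift and returns to its starting
        point, so it can be deleted between \<open>a\<close> and its inverse.\<close>
      have "path_lift x (a \<otimes>\<^bsub>?F\<^esub> b \<otimes>\<^bsub>?F\<^esub> inv\<^bsub>?F\<^esub> a) =
          path_lift x a \<otimes>\<^bsub>Q\<^esub> path_lift (x \<otimes>\<^bsub>G\<^esub> word_value G a) (inv\<^bsub>?F\<^esub> a)"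
        using a b' va x a' path_lift_closed[OF inS[OF a] x] by (simp add: mult)
      also have "\<dots> = path_lift x (a \<otimes>\<^bsub>?F\<^esub> inv\<^bsub>?F\<^esub> a)"
        using mult[OF a a' x] by simp
      finally show ?thesis using a one by simp
    qed
    then show "a \<otimes>\<^bsub>?F\<^esub> b \<otimes>\<^bsub>?F\<^esub> inv\<^bsub>?F\<^esub> a \<in> N"
      using a b' va by (auto simp: N_def kernel_def)
  qed
  moreover have "R \<subseteq> N"
  proof
    fix r assume r: "r \<in> R"
    have RF: "R \<subseteq> carrier ?F"
      and ker: "kernel ?F G (word_value G) = normal_closure ?F R"
      using pres by (auto simp: is_presentation_def)
    have r': "r \<in> kernel ?F G (word_value G)"
      using r RF F.normal_normal_closure(2)[OF RF] ker by blast
    then have "path_lift x r = \<one>\<^bsub>Q\<^esub>" if "x \<in> carrier G" for x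
      using that inS R[OF r] by (intro path_lift_short_loop) (auto simp: kernel_def)
    with r' show "r \<in> N" by (simp add: N_def)
  qed
  ultimately have "normal_closure ?F R \<subseteq> N"
    by (rule normal_closure_subset)
  \<comment> \<open>The word \<open>w\<close> may be unreduced; its reduction is an element of the
    free group and has the same lift.\<close>
  moreover have "reduce w \<in> kernel ?F G (word_value G)"
    using w S G.word_value_reduce[of w] reduce_in_free_group[OF w(1)] by (auto simp: kernel_def)
  ultimately have "reduce w \<in> N"
    using pres by (auto simp: is_presentation_def)
  then show ?thesis
    using path_lift_reduce[OF w(1) x] x by (simp add: N_def)
qed

text \<open>Both words are closed up by the same return path \<open>inv_word v\<close>. The two
  loops have trivial lifts, and the common right factor cancels.\<close>

lemma path_lift_cong:
  assumes pres: "is_presentation G S R" "\<And>r. r \<in> R \<Longrightarrow> length r * k \<le> L"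
    and "fst ` set u \<subseteq> S" "fst ` set v \<subseteq> S" "word_value G u = word_value G v" "x \<in> carrier G"
  shows "path_lift x u = path_lift x v"
proof -
  let ?y = "x \<otimes>\<^bsub>G\<^esub> word_value G v"
  have uv: "fst ` set u \<subseteq> carrier G" "fst ` set v \<subseteq> carrier G"
    using assms S by auto
  have "path_lift x u' \<otimes>\<^bsub>Q\<^esub> path_lift ?y (inv_word v) = \<one>\<^bsub>Q\<^esub>"
    if u': "fst ` set u' \<subseteq> S" "word_value G u' = word_value G v" for u'
  proof -
    have "word_value G (u' @ inv_word v) = \<one>\<^bsub>G\<^esub>"
      using G.word_value_append[of u' "inv_word v"] u' uv S
      by (simp add: G.word_value_inv_word subset_trans)
    then have "path_lift x (u' @ inv_word v) = \<one>\<^bsub>Q\<^esub>"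
      using assms u' by (intro path_lift_loop[OF pres]) (simp_all add: image_Un)
    then show ?thesis
      using path_lift_append[OF u'(1), of "inv_word v" x] assms u' by simp
  qed
  from this[OF assms(3,5)] this[OF assms(4) refl]
  have "path_lift x u \<otimes>\<^bsub>Q\<^esub> path_lift ?y (inv_word v) = path_lift x v \<otimes>\<^bsub>Q\<^esub> path_lift ?y (inv_word v)"
    by simp
  then show ?thesis
    using path_lift_closed[of u x] path_lift_closed[of v x] path_lift_closed[of "inv_word v" ?y]
      assms uv by simp
qed

text \<open>The map \<open>r\<close> built here is equivariant under right multiplication by
  elements of \<open>Q\<close> given by words over \<open>T\<close>. Evaluated at the identity, a
  word that \<open>p\<close> kills fixes \<open>r \<one>\<close>, and cancellation makes its value
  trivial.\<close>

lemma p_kernel_trivial: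
  fixes g :: "'b \<Rightarrow> 'a" and m :: nat
  assumes pres: "is_presentation G S R" "\<And>r. r \<in> R \<Longrightarrow> length r * k \<le> L"
    and g_closed: "\<And>h. h \<in> carrier H \<Longrightarrow> g h \<in> carrier G"
    and g_Lipschitz: "\<And>h l. h \<in> carrier H \<Longrightarrow> fst l \<in> p ` T \<Longrightarrow>
          inv\<^bsub>G\<^esub> g h \<otimes>\<^bsub>G\<^esub> g (h \<otimes>\<^bsub>H\<^esub> letter_value H l) \<in> word_ball G S m"
    and fg: "\<And>h. h \<in> carrier H \<Longrightarrow> inv\<^bsub>H\<^esub> f (g h) \<otimes>\<^bsub>H\<^esub> h \<in> word_ball H (p ` T) k"
    and mL: "k + m * k + k + 1 \<le> L"
    and w: "fst ` set w \<subseteq> T" "p (word_value Q w) = \<one>\<^bsub>H\<^esub>"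
  shows "word_value Q w = \<one>\<^bsub>Q\<^esub>"
proof -
  have "\<exists>u. fst ` set u \<subseteq> S \<and> word_value G u = x" if "x \<in> carrier G" for x
  proof -
    have "x \<in> word_value G ` carrier (free_group S)"
      using pres(1) that by (simp add: is_presentation_def)
    then show ?thesis by (auto simp: free_group_def)
  qed
  then obtain wd where wd: "\<And>x. x \<in> carrier G \<Longrightarrow> fst ` set (wd x) \<subseteq> S"
    "\<And>x. x \<in> carrier G \<Longrightarrow> word_value G (wd x) = x"
    by metis
  \<comment> \<open>The lift of \<open>f\<close> based at the identity. By
    \<open>path_lift_cong\<close> its value does not depend on the chosen word
    \<open>wd x\<close>.\<close>
  define f' where "f' x = path_lift \<one>\<^bsub>G\<^esub> (wd x)" for x
  have f'_closed: "f' x \<in> carrier Q" and hom_f': "p (f' x) = inv\<^bsub>H\<^esub> f \<one>\<^bsub>G\<^esub> \<otimes>\<^bsub>H\<^esub> f x"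
    if "x \<in> carrier G" for x
    using path_lift_closed[OF wd(1)[OF that] G.one_closed] hom_path_lift[OF wd(1)[OF that] G.one_closed]
      wd(2)[OF that] that by (simp_all add: f'_def)
  \<comment> \<open>The word \<open>wd x @ u\<close> and the word chosen for its value have the same
    lift, so \<open>f'\<close> follows every path and not only the chosen ones.\<close>
  have f'_step: "f' (x \<otimes>\<^bsub>G\<^esub> word_value G u) = f' x \<otimes>\<^bsub>Q\<^esub> path_lift x u"
    if x: "x \<in> carrier G" and u: "fst ` set u \<subseteq> S" for x u
  proof -
    have xu: "word_value G u \<in> carrier G" "x \<otimes>\<^bsub>G\<^esub> word_value G u \<in> carrier G"
      using x u S by (auto intro!: G.m_closed G.word_value_closed)
    have "fst ` set u \<subseteq> carrier G" "fst ` set (wd x) \<subseteq> carrier G"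
      using u wd(1)[OF x] S by auto
    then have "word_value G (wd x @ u) = word_value G (wd (x \<otimes>\<^bsub>G\<^esub> word_value G u))"
      using wd(2) x xu by (simp add: G.word_value_append)
    then have "path_lift \<one>\<^bsub>G\<^esub> (wd x @ u) = f' (x \<otimes>\<^bsub>G\<^esub> word_value G u)"
      unfolding f'_def using wd(1) x xu u
      by (intro path_lift_cong[OF pres]) (auto simp: image_Un)
    then show ?thesis
      using path_lift_append[OF wd(1)[OF x] u, of "\<one>\<^bsub>G\<^esub>"] x wd(2)[OF x] by (simp add: f'_def)
  qed
  \<comment> \<open>\<open>e h\<close> lifts the short displacement from \<open>f (g h)\<close> to
    \<open>h\<close>. With this correction \<open>p (r h)\<close> is \<open>h\<close> up to a fixed
    left translation.\<close>
  define e where "e h = short_lift (inv\<^bsub>H\<^esub> f (g h) \<otimes>\<^bsub>H\<^esub> h)" for h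
  define r where "r h = f' (g h) \<otimes>\<^bsub>Q\<^esub> e h" for h
  have e: "e h \<in> word_ball Q T k" "e h \<in> carrier Q" "p (e h) = inv\<^bsub>H\<^esub> f (g h) \<otimes>\<^bsub>H\<^esub> h"
    if "h \<in> carrier H" for h
    using short_lift[OF fg[OF that]] by (auto simp: e_def)
  have r_closed: "r h \<in> carrier Q" and hom_r: "p (r h) = inv\<^bsub>H\<^esub> f \<one>\<^bsub>G\<^esub> \<otimes>\<^bsub>H\<^esub> h"
    if h: "h \<in> carrier H" for h
  proof -
    show "r h \<in> carrier Q"
      using e[OF h] f'_closed g_closed h by (simp add: r_def)
    have "f \<one>\<^bsub>G\<^esub> \<in> carrier H" "f (g h) \<in> carrier H"
      using f_closed g_closed h by auto
    then show "p (r h) = inv\<^bsub>H\<^esub> f \<one>\<^bsub>G\<^esub> \<otimes>\<^bsub>H\<^esub> h"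
      using e[OF h] f'_closed[OF g_closed[OF h]] hom_f'[OF g_closed[OF h]] h
      by (simp add: r_def p.H.m_assoc p.H.inv_mult_cancel)
  qed
  have r_step: "r (h \<otimes>\<^bsub>H\<^esub> p (letter_value Q l)) = r h \<otimes>\<^bsub>Q\<^esub> letter_value Q l"
    if h: "h \<in> carrier H" and l: "fst l \<in> T" for h l
  proof -
    let ?t = "letter_value Q l" and ?h' = "h \<otimes>\<^bsub>H\<^esub> p (letter_value Q l)"
    have t: "?t \<in> carrier Q" "?t \<in> word_ball Q T 1"
      using l T p.G.letter_value_word_ball[OF T p.G.subset_word_ball[OF T] T l] by auto
    have h': "?h' \<in> carrier H" using h t by simp
    have "p ?t = letter_value H (map_prod p (\<lambda>b. b) l)"
      using l T by (auto simp: letter_value_def)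
    then have "inv\<^bsub>G\<^esub> g h \<otimes>\<^bsub>G\<^esub> g ?h' \<in> word_ball G S m"
      using g_Lipschitz[OF h, of "map_prod p (\<lambda>b. b) l"] l by simp
    then obtain u where u: "fst ` set u \<subseteq> S" "length u \<le> m"
      "word_value G u = inv\<^bsub>G\<^esub> g h \<otimes>\<^bsub>G\<^esub> g ?h'"
      by (elim word_ballE)
    let ?d = "path_lift (g h) u"
    have gh: "g h \<in> carrier G" "g ?h' \<in> carrier G" using g_closed h h' by auto
    have d: "?d \<in> carrier Q" "?d \<in> word_ball Q T (m * k)"
      using path_lift_closed[OF u(1) gh(1)] path_lift_word_ball[OF u(1) gh(1)]
        word_ball_mono[of "length u * k" "m * k" Q T] u(2) by auto
    have "f' (g ?h') = f' (g h) \<otimes>\<^bsub>Q\<^esub> ?d"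
      using f'_step[OF gh(1) u(1)] u(3) gh by (simp add: G.inv_mult_cancel)
    then have "inv\<^bsub>Q\<^esub> r h \<otimes>\<^bsub>Q\<^esub> r ?h' = inv\<^bsub>Q\<^esub> e h \<otimes>\<^bsub>Q\<^esub> ?d \<otimes>\<^bsub>Q\<^esub> e ?h'"
      using f'_closed[OF gh(1)] d(1) e(2)[OF h] e(2)[OF h']
      by (simp add: r_def p.G.inv_mult_group p.G.m_assoc p.G.inv_mult_cancel)
    \<comment> \<open>The summands bound, in order, \<open>inv e h\<close>, the lifted path from
      \<open>g h\<close> to \<open>g ?h'\<close>, \<open>e ?h'\<close> and the letter. Their product
      measures the failure of equivariance, and \<open>mL\<close> brings it within reach of
      \<open>p_inj\<close>.\<close>
    then have "inv\<^bsub>Q\<^esub> r h \<otimes>\<^bsub>Q\<^esub> r ?h' \<otimes>\<^bsub>Q\<^esub> inv\<^bsub>Q\<^esub> ?t \<in> word_ball Q T (k + m * k + k + 1)"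
      using d(2) e(1)[OF h] e(1)[OF h'] t(2)
      by (simp only:) (intro p.G.word_ball_mult[OF T] p.G.word_ball_inv[OF T])
    \<comment> \<open>The fixed left translation cancels between \<open>p (r h)\<close> and
      \<open>p (r ?h')\<close>, leaving the letter times its inverse.\<close>
    moreover have "p (inv\<^bsub>Q\<^esub> r h \<otimes>\<^bsub>Q\<^esub> r ?h' \<otimes>\<^bsub>Q\<^esub> inv\<^bsub>Q\<^esub> ?t) = \<one>\<^bsub>H\<^esub>"
    proof -
      have "f \<one>\<^bsub>G\<^esub> \<in> carrier H" using f_closed by simp
      then show ?thesis
        using r_closed[OF h] r_closed[OF h'] t(1) hom_r[OF h] hom_r[OF h'] h
        by (simp add: p.H.inv_mult_group p.H.m_assoc p.H.inv_mult_cancel)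
    qed
    ultimately have "inv\<^bsub>Q\<^esub> r h \<otimes>\<^bsub>Q\<^esub> r ?h' \<otimes>\<^bsub>Q\<^esub> inv\<^bsub>Q\<^esub> ?t = \<one>\<^bsub>Q\<^esub>"
      using p_inj word_ball_mono[OF mL, of Q T] by blast
    moreover have A: "inv\<^bsub>Q\<^esub> r h \<otimes>\<^bsub>Q\<^esub> r ?h' \<in> carrier Q"
      using r_closed[OF h] r_closed[OF h'] by simp
    ultimately have "inv\<^bsub>Q\<^esub> (inv\<^bsub>Q\<^esub> ?t) = inv\<^bsub>Q\<^esub> r h \<otimes>\<^bsub>Q\<^esub> r ?h'"
      using t(1) by (intro p.G.inv_equality) simp_all
    then have "r h \<otimes>\<^bsub>Q\<^esub> (inv\<^bsub>Q\<^esub> r h \<otimes>\<^bsub>Q\<^esub> r ?h') = r h \<otimes>\<^bsub>Q\<^esub> ?t"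
      using t(1) by simp
    then show ?thesis
      unfolding p.G.inv_mult_cancel(1)[OF r_closed[OF h] r_closed[OF h']] .
  qed
  \<comment> \<open>Equivariance passes from letters to words by induction, moving the base point
    \<open>h\<close> along the word.\<close>
  have "r (h \<otimes>\<^bsub>H\<^esub> p (word_value Q w)) = r h \<otimes>\<^bsub>Q\<^esub> word_value Q w" if "h \<in> carrier H" for h
    using w(1) that
  proof (induction w arbitrary: h)
    case Nil
    then show ?case using r_closed by simp
  next
    case (Cons l w)
    have l: "fst l \<in> T" "fst l \<in> carrier Q" and w: "fst ` set w \<subseteq> T" "fst ` set w \<subseteq> carrier Q"
      using Cons.prems T by auto
    have "r (h \<otimes>\<^bsub>H\<^esub> p (letter_value Q l) \<otimes>\<^bsub>H\<^esub> p (word_value Q w)) =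
        r h \<otimes>\<^bsub>Q\<^esub> letter_value Q l \<otimes>\<^bsub>Q\<^esub> word_value Q w"
      using Cons.IH[OF w(1), of "h \<otimes>\<^bsub>H\<^esub> p (letter_value Q l)"] r_step[OF Cons.prems(2) l(1)]
        Cons.prems(2) l by simp
    then show ?case
      using l w Cons.prems(2) r_closed by (simp add: p.H.m_assoc p.G.m_assoc)
  qed
  from this[OF p.H.one_closed] have "r \<one>\<^bsub>H\<^esub> = r \<one>\<^bsub>H\<^esub> \<otimes>\<^bsub>Q\<^esub> word_value Q w"
    using w(2) by simp
  moreover have "word_value Q w \<in> carrier Q"
    using w(1) T by (intro p.G.word_value_closed) auto
  ultimately show ?thesis
    using r_closed[OF p.H.one_closed] by simp
qed

end

section \<open>Transfer of presentations\<close>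

lemma singleton_in_free_group: "t \<in> T \<Longrightarrow> [(t, b)] \<in> carrier (free_group T)"
  by (simp add: free_group_def reduced_def)

lemma letter_value_free_group:
  assumes "t \<in> T"
  shows "letter_value (free_group T) ([(t, True)], b) = [(t, b)]"
proof -
  interpret F: group "free_group T" by (rule group_free_group)
  have "inv\<^bsub>free_group T\<^esub> [(t, True)] = [(t, False)]"
    using assms by (intro F.inv_equality)
      (simp_all add: singleton_in_free_group mult_free_group one_free_group reduce_def inv_letter_def)
  then show ?thesis by (simp add: letter_value_def)
qed

text \<open>Here a word over \<open>T\<close> is read as a word whose letters are elements of the
  free group. Multiplying these out is free reduction, which links words in the quotient
  \<open>Q\<close> to cosets.\<close>

lemma word_value_free_group:
  assumes "fst ` set w \<subseteq> T"
  shows "word_value (free_group T) (map (map_prod (\<lambda>t. [(t, True)]) (\<lambda>b. b)) w) = reduce w"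
  using assms
proof (induction w)
  case Nil
  interpret F: group "free_group T" by (rule group_free_group)
  show ?case by (simp add: one_free_group reduce_def)
next
  case (Cons l w)
  interpret F: group "free_group T" by (rule group_free_group)
  obtain t b where l: "l = (t, b)" by (cases l)
  have "reduce ([l] @ reduce w) = reduce ([l] @ w)"
    by (rule reduce_reduce_append)
  with Cons l show ?case by (simp add: letter_value_free_group mult_free_group)
qed

text \<open>Free reduction never lengthens a word. Hence short elements of a quotient of the free
  group are represented by short reduced words, which can serve as relators.\<close>

lemma word_ball_free_group:
  assumes "x \<in> word_ball (free_group T) ((\<lambda>t. [(t, True)]) ` T) n"
  shows "x \<in> carrier (free_group T)" "length x \<le> n"
proof -
  interpret F: group "free_group T" by (rule group_free_group)
  have sub: "(\<lambda>t. [(t, True)]) ` T \<subseteq> carrier (free_group T)"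
    by (auto simp: singleton_in_free_group)
  with assms show "x \<in> carrier (free_group T)"
    using F.word_ball_closed by blast
  obtain u where u: "fst ` set u \<subseteq> (\<lambda>t. [(t, True)]) ` T" "length u \<le> n"
    "word_value (free_group T) u = x"
    using assms by (elim word_ballE)
  have "length (word_value (free_group T) u) \<le> length u"
    using u(1)
  proof (induction u)
    case Nil
    show ?case by (simp add: one_free_group)
  next
    case (Cons l u)
    then obtain t b where "t \<in> T" "l = ([(t, True)], b)"
      by (cases l) auto
    then have "length (letter_value (free_group T) l) = 1"
      by (simp add: letter_value_free_group)
    with Cons show ?case
      using length_reduce[of "letter_value (free_group T) l @ word_value (free_group T) u"]
      by (simp add: mult_free_group)
  qed
  with u show "length x \<le> n" by simp
qed

text \<open>All relations of length at most \<open>L\<close> that hold in \<open>H\<close> are taken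
  as relators. Injectivity of the projection from \<open>?Q\<close> at scale \<open>L\<close> is
  then automatic, and \<open>p_kernel_trivial\<close> upgrades it to full injectivity.\<close>

lemma boundedly_presented_transfer:
  assumes G: "group G" and H: "group H"
    and pres: "is_presentation G S R" and R: "\<And>r. r \<in> R \<Longrightarrow> length r \<le> n"
    and T: "T \<subseteq> carrier H" "generate H T = carrier H"
    and f_closed: "\<And>x. x \<in> carrier G \<Longrightarrow> f x \<in> carrier H"
    and f_Lipschitz: "\<And>x l. x \<in> carrier G \<Longrightarrow> fst l \<in> S \<Longrightarrow>
          inv\<^bsub>H\<^esub> f x \<otimes>\<^bsub>H\<^esub> f (x \<otimes>\<^bsub>G\<^esub> letter_value G l) \<in> word_ball H T k"
    and g_closed: "\<And>h. h \<in> carrier H \<Longrightarrow> g h \<in> carrier G"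
    and g_Lipschitz: "\<And>h l. h \<in> carrier H \<Longrightarrow> fst l \<in> T \<Longrightarrow>
          inv\<^bsub>G\<^esub> g h \<otimes>\<^bsub>G\<^esub> g (h \<otimes>\<^bsub>H\<^esub> letter_value H l) \<in> word_ball G S m"
    and fg: "\<And>h. h \<in> carrier H \<Longrightarrow> inv\<^bsub>H\<^esub> f (g h) \<otimes>\<^bsub>H\<^esub> h \<in> word_ball H T k"
  shows "boundedly_presented H T"
proof -
  let ?F = "free_group T" and ?s = "\<lambda>t. [(t, True)]"
  \<comment> \<open>The summands cover in turn the lifted relators of \<open>G\<close>, the lifted
    backtracks and the error bounded in \<open>p_kernel_trivial\<close>.\<close>
  define L where "L = n * k + 2 * k + (k + m * k + k + 1)"
  define R' where "R' = {w \<in> carrier ?F. length w \<le> L \<and> word_value H w = \<one>\<^bsub>H\<^esub>}"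
  define N where "N = normal_closure ?F R'"
  interpret G: group G by (rule G)
  interpret H: group H by (rule H)
  interpret F: group ?F by (rule group_free_group)
  interpret v: group_hom ?F H "word_value H"
    using H.word_value_hom[OF T(1)] by unfold_locales
  have R'F: "R' \<subseteq> carrier ?F" by (auto simp: R'_def)
  interpret N: normal N ?F
    using F.normal_normal_closure(1)[OF R'F] by (simp add: N_def)
  have R'N: "R' \<subseteq> N"
    using F.normal_normal_closure(2)[OF R'F] by (simp add: N_def)
  have N_kernel: "N \<subseteq> kernel ?F H (word_value H)"
    unfolding N_def by (intro normal_closure_subset v.normal_kernel) (auto simp: R'_def kernel_def)
  let ?Q = "?F Mod N" and ?\<pi> = "\<lambda>x. N #>\<^bsub>?F\<^esub> x"
  interpret Q: group ?Q by (rule N.factorgroup_is_group)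
  interpret \<pi>: group_hom ?F ?Q ?\<pi>
    using N.r_coset_hom_Mod by unfold_locales
  \<comment> \<open>The value in \<open>H\<close> is constant on cosets of \<open>N\<close>, so it
    factors through the quotient as \<open>p\<close>.\<close>
  have "word_value H x = word_value H y"
    if xy: "x \<in> carrier ?F" "y \<in> carrier ?F" "?\<pi> x = ?\<pi> y" for x y
  proof -
    have "x \<in> ?\<pi> y"
      using F.repr_independenceD[OF N.subgroup_axioms xy(1), of y] xy(3) by simp
    then obtain z where "z \<in> N" "x = z \<otimes>\<^bsub>?F\<^esub> y"
      by (auto simp: r_coset_def)
    then show ?thesis
      using N_kernel xy by (auto simp: kernel_def)
  qed
  from FactGroup_universal[OF v.homh N.normal_axioms this]
  obtain p where p: "p \<in> hom ?Q H" "\<And>x. x \<in> carrier ?F \<Longrightarrow> p (?\<pi> x) = word_value H x"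
    by metis
  interpret p: group_hom ?Q H p
    using p(1) by unfold_locales
  let ?T' = "?\<pi> ` ?s ` T"
  have sT: "?s ` T \<subseteq> carrier ?F"
    by (auto simp: singleton_in_free_group)
  have T': "?T' \<subseteq> carrier ?Q"
    using sT \<pi>.hom_closed by blast
  \<comment> \<open>Hence balls of \<open>H\<close> over the image of \<open>?T'\<close> are the
    balls over \<open>T\<close> in which the hypotheses are stated.\<close>
  have "p (?\<pi> (?s t)) = t" if "t \<in> T" for t
    using that T(1) p(2)[OF singleton_in_free_group[OF that]] by (auto simp: letter_value_def)
  then have pT': "p ` ?T' = T"
    by (force simp: image_image)
  \<comment> \<open>Such a \<open>q\<close> is the coset of a reduced word of length at most
    \<open>L\<close>. If \<open>p q\<close> is trivial, that word is itself one of the relators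
    \<open>R'\<close>.\<close>
  have p_inj: "q = \<one>\<^bsub>?Q\<^esub>" if q: "q \<in> word_ball ?Q ?T' L" "p q = \<one>\<^bsub>H\<^esub>" for q
  proof -
    have "q \<in> ?\<pi> ` word_ball ?F (?s ` T) L"
      using q(1) \<pi>.word_ball_image[OF sT, of L] by simp
    then obtain x where "x \<in> word_ball ?F (?s ` T) L" "q = ?\<pi> x"
      by blast
    with word_ball_free_group[OF this(1)] q(2) p(2) have "x \<in> R'" "q = ?\<pi> x"
      by (auto simp: R'_def)
    then show ?thesis
      using R'N F.coset_join2[OF _ N.subgroup_axioms, of x] by auto
  qed
  have S: "S \<subseteq> carrier G"
    using pres by (simp add: is_presentation_def)
  interpret lift: lifting G ?Q H p S ?T' f k L
    using S T' f_closed f_Lipschitz p_inj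
    by unfold_locales (simp_all only: pT', simp add: L_def)
  have "kernel ?F H (word_value H) \<subseteq> N"
  proof
    fix x assume "x \<in> kernel ?F H (word_value H)"
    then have x: "x \<in> carrier ?F" "word_value H x = \<one>\<^bsub>H\<^esub>" "fst ` set x \<subseteq> T" "reduced x"
      by (auto simp: kernel_def free_group_def)
    \<comment> \<open>The word \<open>x\<close> with each letter replaced by its class in
      \<open>?Q\<close>; its value there is the coset of \<open>x\<close>, so triviality of that
      value means \<open>x \<in> N\<close>.\<close>
    define w where "w = map (map_prod ?\<pi> (\<lambda>b. b)) (map (map_prod ?s (\<lambda>b. b)) x)"
    have "fst ` set (map (map_prod ?s (\<lambda>b. b)) x) \<subseteq> carrier ?F"
      using x(3) sT by (auto simp: subset_iff)
    then have w: "word_value ?Q w = ?\<pi> x"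
      using \<pi>.hom_word_value[of "map (map_prod ?s (\<lambda>b. b)) x"] word_value_free_group[OF x(3)]
        reduce_id[OF x(4)] by (simp add: w_def)
    have "word_value ?Q w = \<one>\<^bsub>?Q\<^esub>"
    proof (rule lift.p_kernel_trivial[OF pres, of g m])
      show "length r * k \<le> L" if "r \<in> R" for r
        using mult_le_mono1[OF R[OF that], of k] unfolding L_def by linarith
      show "fst ` set w \<subseteq> ?T'"
        using x(3) by (auto simp: w_def)
      show "p (word_value ?Q w) = \<one>\<^bsub>H\<^esub>"
        using w p(2) x by simp
      show "g h \<in> carrier G" if "h \<in> carrier H" for h
        using that by (rule g_closed)
      show "inv\<^bsub>G\<^esub> g h \<otimes>\<^bsub>G\<^esub> g (h \<otimes>\<^bsub>H\<^esub> letter_value H l) \<in> word_ball G S m"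
        if "h \<in> carrier H" "fst l \<in> p ` ?T'" for h l
        using that unfolding pT' by (rule g_Lipschitz)
      show "inv\<^bsub>H\<^esub> f (g h) \<otimes>\<^bsub>H\<^esub> h \<in> word_ball H (p ` ?T') k" if "h \<in> carrier H" for h
        using that unfolding pT' by (rule fg)
      show "k + m * k + k + 1 \<le> L" by (simp add: L_def)
    qed
    then show "x \<in> N"
      using w x(1) N.subgroup_axioms F.coset_join1 by (metis one_FactGroup)
  qed
  with N_kernel have ker: "kernel ?F H (word_value H) = normal_closure ?F R'"
    by (auto simp: N_def)
  have "word_value H ` carrier ?F = carrier H"
  proof
    show "word_value H ` carrier ?F \<subseteq> carrier H"
      using v.hom_closed by blast
    show "carrier H \<subseteq> word_value H ` carrier ?F"
    proof
      fix y assume "y \<in> carrier H"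
      then obtain w where w: "fst ` set w \<subseteq> T" "word_value H w = y"
        using H.carrier_eq_word_value[OF T] by blast
      then have "word_value H (reduce w) = y"
        using H.word_value_reduce[of w] T(1) by blast
      then show "y \<in> word_value H ` carrier ?F"
        using reduce_in_free_group[OF w(1)] by blast
    qed
  qed
  with ker T(1) R'F have "is_presentation H T R'"
    by (simp add: is_presentation_def)
  then show ?thesis
    unfolding boundedly_presented_def by (intro exI[of _ R'] exI[of _ L]) (simp add: R'_def)
qed

section \<open>From quasi-isometries to bounds on words\<close>

lemma quasi_isometricE:
  assumes "quasi_isometric X Y"
  obtains f g A B \<alpha> \<beta> C \<gamma> where "f \<in> mspace X \<rightarrow> mspace Y" "g \<in> mspace Y \<rightarrow> mspace X"
    "0 \<le> A" "0 \<le> B" "0 \<le> \<alpha>" "0 \<le> \<beta>" "0 \<le> C" "0 \<le> \<gamma>"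
    "\<forall>x\<in>mspace X. \<forall>x'\<in>mspace X. mdist Y (f x) (f x') \<le> A * mdist X x x' + B"
    "\<forall>y\<in>mspace Y. \<forall>y'\<in>mspace Y. mdist X (g y) (g y') \<le> \<alpha> * mdist Y y y' + \<beta>"
    "\<forall>x\<in>mspace X. mdist X (g (f x)) x \<le> C"
    "\<forall>y\<in>mspace Y. mdist Y (f (g y)) y \<le> \<gamma>"
proof -
  obtain f g A B \<alpha> \<beta> C \<gamma> where "f \<in> mspace X \<rightarrow> mspace Y \<and> g \<in> mspace Y \<rightarrow> mspace X \<and>
      0 \<le> A \<and> 0 \<le> B \<and> 0 \<le> \<alpha> \<and> 0 \<le> \<beta> \<and> 0 \<le> C \<and> 0 \<le> \<gamma> \<and>
      (\<forall>x\<in>mspace X. \<forall>x'\<in>mspace X. mdist Y (f x) (f x') \<le> A * mdist X x x' + B) \<and>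
      (\<forall>y\<in>mspace Y. \<forall>y'\<in>mspace Y. mdist X (g y) (g y') \<le> \<alpha> * mdist Y y y' + \<beta>) \<and>
      (\<forall>x\<in>mspace X. mdist X (g (f x)) x \<le> C) \<and>
      (\<forall>y\<in>mspace Y. mdist Y (f (g y)) y \<le> \<gamma>)"
    using assms unfolding quasi_isometric_def by (elim exE) (rule that)
  then show thesis
    by (elim conjE) (rule that[of f g A B \<alpha> \<beta> C \<gamma>])
qed

lemma quasi_isometric_sym:
  assumes "quasi_isometric X Y"
  shows "quasi_isometric Y X"
  using assms
proof (rule quasi_isometricE)
  fix f g A B \<alpha> \<beta> C \<gamma>
  assume *: "f \<in> mspace X \<rightarrow> mspace Y" "g \<in> mspace Y \<rightarrow> mspace X"
    "0 \<le> A" "0 \<le> B" "0 \<le> \<alpha>" "0 \<le> \<beta>" "0 \<le> C" "0 \<le> \<gamma>"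
    "\<forall>x\<in>mspace X. \<forall>x'\<in>mspace X. mdist Y (f x) (f x') \<le> A * mdist X x x' + B"
    "\<forall>y\<in>mspace Y. \<forall>y'\<in>mspace Y. mdist X (g y) (g y') \<le> \<alpha> * mdist Y y y' + \<beta>"
    "\<forall>x\<in>mspace X. mdist X (g (f x)) x \<le> C"
    "\<forall>y\<in>mspace Y. mdist Y (f (g y)) y \<le> \<gamma>"
  show "quasi_isometric Y X"
    unfolding quasi_isometric_def
    by (rule exI[of _ g], rule exI[of _ f], rule exI[of _ \<alpha>], rule exI[of _ \<beta>],
      rule exI[of _ A], rule exI[of _ B], rule exI[of _ \<gamma>], rule exI[of _ C]) (intro conjI *)
qed

lemma is_presentation_generate:
  assumes "group G" "is_presentation G S R"
  shows "generate G S = carrier G"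
proof
  interpret group G by (rule assms(1))
  have S: "S \<subseteq> carrier G" "word_value G ` carrier (free_group S) = carrier G"
    using assms(2) by (simp_all add: is_presentation_def)
  show "generate G S \<subseteq> carrier G"
    using generate_incl[OF S(1)] .
  have "word_value G w \<in> generate G S" if "w \<in> carrier (free_group S)" for w
    using that by (intro word_value_generate[OF S(1)]) (simp add: free_group_def)
  then have "word_value G ` carrier (free_group S) \<subseteq> generate G S"
    by (rule image_subsetI)
  then show "carrier G \<subseteq> generate G S"
    unfolding S(2) .
qed

text \<open>The compact set \<open>S'\<close> that presents \<open>G\<close> may differ from
  \<open>S\<close>. Both are compact generating sets, so each lies in a ball over the other, and the
  estimates carry over to \<open>S'\<close>. The result is a bounded presentation of
  \<open>H\<close> over \<open>T\<close>.\<close>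

lemma compactly_presented_quasi_isometric:
  fixes G :: "('a, 'm) monoid_scheme" and H :: "('b, 'n) monoid_scheme"
  assumes "locally_compact_group G X" and GS: "compact_generating_set G X S"
    and "locally_compact_group H Y" and HT: "compact_generating_set H Y T"
    and qi: "quasi_isometric (word_metric G S) (word_metric H T)"
    and cp: "compactly_presented G X"
  shows "compactly_presented H Y"
proof -
  interpret G: locally_compact_group G X by fact
  interpret H: locally_compact_group H Y by fact
  obtain S' where S': "compactin X S'" "boundedly_presented G S'"
    using cp unfolding compactly_presented_def by (elim conjE exE)
  then obtain R n where pres: "is_presentation G S' R" and "\<forall>r\<in>R. length r \<le> n"
    unfolding boundedly_presented_def by (elim conjE exE)
  then have R: "\<And>r. r \<in> R \<Longrightarrow> length r \<le> n" by simp
  have S: "compactin X S" "S \<subseteq> carrier G" "generate G S = carrier G"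
    using GS G.compactin_subset_carrier[of S] by (simp_all add: compact_generating_set_def)
  have T: "compactin Y T" "T \<subseteq> carrier H" "generate H T = carrier H"
    using HT H.compactin_subset_carrier[of T] by (simp_all add: compact_generating_set_def)
  have S'G: "S' \<subseteq> carrier G" "compact_generating_set G X S'"
    using S' is_presentation_generate[OF G.group_axioms pres] G.compactin_subset_carrier[of S']
    by (simp_all add: compact_generating_set_def)
  obtain a where a: "S' \<subseteq> word_ball G S a"
    by (rule G.compactin_subset_word_ball[OF GS S'(1)])
  obtain b where b: "S \<subseteq> word_ball G S' b"
    by (rule G.compactin_subset_word_ball[OF S'G(2) S(1)])
  have met: "mspace (word_metric G S) = carrier G" "mdist (word_metric G S) = word_dist G S"
    "mspace (word_metric H T) = carrier H" "mdist (word_metric H T) = word_dist H T"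
    by (rule G.word_metric_simps[OF S(2,3)] H.word_metric_simps[OF T(2,3)])+
  obtain f g A B \<alpha> \<beta> C \<gamma> where fg: "f \<in> carrier G \<rightarrow> carrier H" "g \<in> carrier H \<rightarrow> carrier G"
    "0 \<le> A" "0 \<le> B" "0 \<le> \<alpha>" "0 \<le> \<beta>" "0 \<le> C" "0 \<le> \<gamma>"
    "\<forall>x\<in>carrier G. \<forall>x'\<in>carrier G. word_dist H T (f x) (f x') \<le> A * word_dist G S x x' + B"
    "\<forall>y\<in>carrier H. \<forall>y'\<in>carrier H. word_dist G S (g y) (g y') \<le> \<alpha> * word_dist H T y y' + \<beta>"
    "\<forall>x\<in>carrier G. word_dist G S (g (f x)) x \<le> C"
    "\<forall>y\<in>carrier H. word_dist H T (f (g y)) y \<le> \<gamma>"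
    by (rule quasi_isometricE[OF qi, unfolded met])
  have f: "f x \<in> carrier H" if "x \<in> carrier G" for x using fg(1) that by blast
  have g: "g y \<in> carrier G" if "y \<in> carrier H" for y using fg(2) that by blast
  \<comment> \<open>A letter over \<open>S'\<close> has length at most \<open>a\<close> over
    \<open>S\<close>, so \<open>A * real a + B\<close> bounds the image of one edge. The maximum
    lets the same \<open>k\<close> bound the distance from \<open>f (g h)\<close> to
    \<open>h\<close>.\<close>
  define k where "k = nat \<lceil>max (A * real a + B) \<gamma>\<rceil>"
  \<comment> \<open>An edge labelled by a letter over \<open>T\<close> has length at most 1, so
    \<open>g\<close> stretches it to at most \<open>\<alpha> + \<beta>\<close>.\<close>
  define j where "j = nat \<lceil>\<alpha> + \<beta>\<rceil>"
  have k: "A * real a + B \<le> real k" "\<gamma> \<le> real k"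
    using real_nat_ceiling_ge[of "max (A * real a + B) \<gamma>"] by (simp_all add: k_def)
  have j: "\<alpha> + \<beta> \<le> real j"
    unfolding j_def by (rule real_nat_ceiling_ge)
  have "boundedly_presented H T"
  proof (rule boundedly_presented_transfer[OF G.group_axioms H.group_axioms pres R T(2,3) f _ g])
    fix x and l :: "'a letter" assume x: "x \<in> carrier G" and l: "fst l \<in> S'"
    let ?x' = "x \<otimes>\<^bsub>G\<^esub> letter_value G l"
    have lG: "letter_value G l \<in> carrier G" "letter_value G l \<in> word_ball G S a"
      using l S'G(1) G.letter_value_word_ball[OF S'G(1) a S(2) l] by auto
    then have x': "?x' \<in> carrier G" "inv\<^bsub>G\<^esub> x \<otimes>\<^bsub>G\<^esub> ?x' \<in> word_ball G S a"
      using x by (simp_all add: G.inv_mult_cancel)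
    then have "word_dist G S x ?x' \<le> real a"
      using G.word_dist_le_iff[OF S(2,3) x x'(1)] by simp
    then have "A * word_dist G S x ?x' \<le> A * real a"
      using fg(3) by (rule mult_left_mono)
    then have "word_dist H T (f x) (f ?x') \<le> real k"
      using fg(9)[rule_format, OF x x'(1)] k(1) by linarith
    then show "inv\<^bsub>H\<^esub> f x \<otimes>\<^bsub>H\<^esub> f ?x' \<in> word_ball H T k"
      using H.word_dist_le_iff[OF T(2,3) f[OF x] f[OF x'(1)]] by simp
  next
    fix h and l :: "'b letter" assume h: "h \<in> carrier H" and l: "fst l \<in> T"
    let ?h' = "h \<otimes>\<^bsub>H\<^esub> letter_value H l"
    have lH: "letter_value H l \<in> carrier H" "letter_value H l \<in> word_ball H T 1"
      using l T(2) H.letter_value_word_ball[OF T(2) H.subset_word_ball[OF T(2)] T(2) l] by auto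
    then have h': "?h' \<in> carrier H" "inv\<^bsub>H\<^esub> h \<otimes>\<^bsub>H\<^esub> ?h' \<in> word_ball H T 1"
      using h by (simp_all add: H.inv_mult_cancel)
    then have "word_dist H T h ?h' \<le> 1"
      using H.word_dist_le_iff[OF T(2,3) h h'(1), of 1] by simp
    then have "\<alpha> * word_dist H T h ?h' \<le> \<alpha> * 1"
      using fg(5) by (rule mult_left_mono)
    then have "word_dist G S (g h) (g ?h') \<le> real j"
      using fg(10)[rule_format, OF h h'(1)] j by linarith
    then have "inv\<^bsub>G\<^esub> g h \<otimes>\<^bsub>G\<^esub> g ?h' \<in> word_ball G S j"
      using G.word_dist_le_iff[OF S(2,3) g[OF h] g[OF h'(1)]] by simp
    \<comment> \<open>The bound for \<open>g\<close> is measured over \<open>S\<close>; rewriting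
      each letter over \<open>S'\<close> costs a factor \<open>b\<close>.\<close>
    then show "inv\<^bsub>G\<^esub> g h \<otimes>\<^bsub>G\<^esub> g ?h' \<in> word_ball G S' (j * b)"
      using G.word_ball_subset_word_ball[OF S(2) S'G(1) b, of j] by blast
  next
    fix h assume h: "h \<in> carrier H"
    have "word_dist H T (f (g h)) h \<le> real k"
      using fg(12)[rule_format, OF h] k(2) by linarith
    then show "inv\<^bsub>H\<^esub> f (g h) \<otimes>\<^bsub>H\<^esub> h \<in> word_ball H T k"
      using H.word_dist_le_iff[OF T(2,3) f[OF g[OF h]] h] by simp
  qed
  with T(1) H.Hausdorff show ?thesis
    by (auto simp: compactly_presented_def)
qed

theorem corollary4p11:
  fixes G :: "('a, 'm) monoid_scheme" and X :: "'a topology" and S :: "'a set"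
    and H :: "('b, 'n) monoid_scheme" and Y :: "'b topology" and T :: "'b set"
  assumes "locally_compact_group G X" and "compact_generating_set G X S"
    and "locally_compact_group H Y" and "compact_generating_set H Y T"
    and "quasi_isometric (word_metric G S) (word_metric H T)"
  shows "compactly_presented G X \<longleftrightarrow> compactly_presented H Y"
  using compactly_presented_quasi_isometric[OF assms]
    compactly_presented_quasi_isometric[OF assms(3,4,1,2) quasi_isometric_sym[OF assms(5)]]
  by blast

end
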